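(* If $g$ is a nonsingular entropy maximizer with Lagrange multipliers $(\alpha,\beta)$, then $g$ agrees off a set of measure zero with a graphon for which every column maximizes the worth functional $W$ (over all Borel measurable functions $C:[0,1]\to[0,1]$). In particular, every column must have the same worth.
   Context: A graphon is a symmetric Borel measurable function $g:[0,1]^2\to[0,1]$, with functions that agree almost everywhere identified. Put $\varepsilon(g)=\iint g\,dx\,dy$, $\tau(g)=\iiint g(x,y)g(y,z)g(z,x)\,dx\,dy\,dz$, and $S(g)=\iint H(g(x,y))\,dx\,dy$ with $H(u)=-[u\ln u+(1-u)\ln(1-u)]$ (and $H(0)=H(1)=0$), so $H'(u)=\ln\frac{1-u}{u}$. An entropy maximizer is a graphon $g$ that maximizes $S$ among all graphons with the same edge density $e=\varepsilon(g)$ and triangle density $t=\tau(g)$. Let $G(x,y)=\int_0^1 g(x,z)g(y,z)\,dz$. An entropy maximizer is nonsingular if $G$ is not (a.e.) constant on the set where $0<g(x,y)<1$. For a nonsingular entropy maximizer there are unique real numbers $\alpha,\beta$, its Lagrange multipliers, such that $H'(g(x,y))=\alpha+\beta G(x,y)$ almost everywhere. The columns of $g$ are the functions $g_x(y)=g(x,y)$, $x\in[0,1]$. The worth of a Borel measurable function $C:[0,1]\to[0,1]$ is $$W(C)=2\int_0^1 H(C(y))\,dy-2\alpha\int_0^1 C(y)\,dy-\beta\iint C(y)C(z)g(y,z)\,dy\,dz .$$ *)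

theory Defs
  imports "HOL-Analysis.Analysis" "HOL-Real_Asymp.Real_Asymp"
begin

abbreviation unit_interval :: "real measure" where
  "unit_interval \<equiv> restrict_space lborel {0..1}"

text \<open>
  Functions on \<open>[0,1]\<close> and \<open>[0,1]\<^sup>2\<close> are total HOL functions; their values outside
  the unit interval are unconstrained and never used. Graphons are curried, so that the
  column at \<open>x\<close> is the partial application \<open>g x\<close>.
\<close>

definition unit_function :: "(real \<Rightarrow> real) \<Rightarrow> bool" where
  "unit_function C \<longleftrightarrow>
     C \<in> borel_measurable unit_interval \<and> (\<forall>y\<in>{0..1}. C y \<in> {0..1})"

definition graphon :: "(real \<Rightarrow> real \<Rightarrow> real) \<Rightarrow> bool" where
  "graphon g \<longleftrightarrow>
     (\<lambda>(x, y). g x y) \<in> borel_measurable (unit_interval \<Otimes>\<^sub>M unit_interval) \<and>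
     (\<forall>x\<in>{0..1}. \<forall>y\<in>{0..1}. g x y \<in> {0..1} \<and> g x y = g y x)"

definition edge_density :: "(real \<Rightarrow> real \<Rightarrow> real) \<Rightarrow> real" where
  "edge_density g = (LINT x|unit_interval. LINT y|unit_interval. g x y)"

definition triangle_density :: "(real \<Rightarrow> real \<Rightarrow> real) \<Rightarrow> real" where
  "triangle_density g =
     (LINT x|unit_interval. LINT y|unit_interval. LINT z|unit_interval. g x y * g y z * g z x)"

text \<open>The values at 0 and 1 are 0, because \<open>ln 0 = 0\<close> in HOL.\<close>

definition H :: "real \<Rightarrow> real" where
  "H u = - (u * ln u + (1 - u) * ln (1 - u))"

definition graphon_entropy :: "(real \<Rightarrow> real \<Rightarrow> real) \<Rightarrow> real" where
  "graphon_entropy g = (LINT x|unit_interval. LINT y|unit_interval. H (g x y))"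

definition entropy_maximizer :: "(real \<Rightarrow> real \<Rightarrow> real) \<Rightarrow> bool" where
  "entropy_maximizer g \<longleftrightarrow>
     graphon g \<and>
     (\<forall>h. graphon h \<longrightarrow> edge_density h = edge_density g \<longrightarrow>
          triangle_density h = triangle_density g \<longrightarrow> graphon_entropy h \<le> graphon_entropy g)"

definition codegree :: "(real \<Rightarrow> real \<Rightarrow> real) \<Rightarrow> real \<Rightarrow> real \<Rightarrow> real" where
  "codegree g x y = (LINT z|unit_interval. g x z * g y z)"

definition nonsingular :: "(real \<Rightarrow> real \<Rightarrow> real) \<Rightarrow> bool" where
  "nonsingular g \<longleftrightarrow>
     \<not> (\<exists>c. AE (x, y) in unit_interval \<Otimes>\<^sub>M unit_interval.
              0 < g x y \<and> g x y < 1 \<longrightarrow> codegree g x y = c)"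

text \<open>
  The equation \<open>H'(g(x,y)) = \<alpha> + \<beta> G(x,y)\<close> is stated with the derivative of \<open>H\<close> on
  \<open>[0,1]\<close> rather than with the formula \<open>ln ((1 - u) / u)\<close>, which HOL totalises to 0 at the
  end points, where \<open>H'\<close> is in fact infinite.
\<close>

definition lagrange_multipliers :: "(real \<Rightarrow> real \<Rightarrow> real) \<Rightarrow> real \<Rightarrow> real \<Rightarrow> bool" where
  "lagrange_multipliers g \<alpha> \<beta> \<longleftrightarrow>
     (AE (x, y) in unit_interval \<Otimes>\<^sub>M unit_interval.
        (H has_real_derivative \<alpha> + \<beta> * codegree g x y) (at (g x y) within {0..1}))"

lemma H_has_real_derivative_iff:
  assumes "u \<in> {0..1}"
  shows "(H has_real_derivative D) (at u within {0..1}) \<longleftrightarrow>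
           0 < u \<and> u < 1 \<and> D = ln ((1 - u) / u)"
proof -
  have lim0: "LIM h at_right 0. (H h - H 0) / (h - 0) :> at_top"
    unfolding H_def by simp real_asymp
  have lim1: "LIM h at_left 1. (H h - H 1) / (h - 1) :> at_bot"
    unfolding H_def by simp real_asymp
  have "\<not> (H has_real_derivative D) (at 0 within {0..1})"
    using lim0 by (auto simp: has_field_derivative_iff at_within_Icc_at_right
        dest: not_tendsto_and_filterlim_at_infinity[OF trivial_limit_at_right_real _
            filterlim_at_top_imp_at_infinity])
  moreover have "\<not> (H has_real_derivative D) (at 1 within {0..1})"
    using lim1 by (auto simp: has_field_derivative_iff at_within_Icc_at_left
        dest: not_tendsto_and_filterlim_at_infinity[OF trivial_limit_at_left_real _
            filterlim_at_bot_imp_at_infinity])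
  moreover have "(H has_real_derivative D) (at u within {0..1}) \<longleftrightarrow> D = ln ((1 - u) / u)"
    if "0 < u" "u < 1"
  proof -
    have *: "(H has_real_derivative ln ((1 - u) / u)) (at u)"
      unfolding H_def using that
      by (auto intro!: derivative_eq_intros simp: ln_div)
    have "at u within {0..1} = at u"
      using that by (intro at_within_interior) simp
    then show ?thesis
      using * DERIV_unique by metis
  qed
  ultimately show ?thesis
    using assms by (cases "u = 0 \<or> u = 1") auto
qed

definition worth :: "(real \<Rightarrow> real \<Rightarrow> real) \<Rightarrow> real \<Rightarrow> real \<Rightarrow> (real \<Rightarrow> real) \<Rightarrow> real" where
  "worth g \<alpha> \<beta> C =
     2 * (LINT y|unit_interval. H (C y)) - 2 * \<alpha> * (LINT y|unit_interval. C y)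
       - \<beta> * (LINT y|unit_interval. LINT z|unit_interval. C y * C z * g y z)"

definition worth_maximizer :: "(real \<Rightarrow> real \<Rightarrow> real) \<Rightarrow> real \<Rightarrow> real \<Rightarrow> (real \<Rightarrow> real) \<Rightarrow> bool" where
  "worth_maximizer g \<alpha> \<beta> C \<longleftrightarrow>
     unit_function C \<and> (\<forall>D. unit_function D \<longrightarrow> worth g \<alpha> \<beta> D \<le> worth g \<alpha> \<beta> C)"

end

theory Submission
  imports Defs
begin

text \<open>
  Give a new vertex class of small mass \<open>\<delta>\<close> the column \<open>C\<close>, shrinking \<open>g\<close> to mass \<open>1 - \<delta>\<close>. To first
  order in \<open>\<delta>\<close> this changes \<open>S - \<alpha> \<epsilon> - \<beta> \<tau> / 3\<close> by \<open>\<delta> (W(C) - W\<^sub>0)\<close> with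
  \<open>W\<^sub>0 = 2 S(g) - 2 \<alpha> \<epsilon>(g) - \<beta> \<tau>(g)\<close>, which is the average worth of the columns of \<open>g\<close>. Since \<open>G\<close> is
  not constant, a perturbation \<open>a + b \<psi>\<close> of the old part with \<open>\<psi> = G - \<integral>\<integral>G\<close> and \<open>a, b = O(\<delta>)\<close> restores
  both densities: \<open>a\<close> solves the affine equation for the edges, and \<open>b\<close> comes from the intermediate
  value theorem. By the multiplier equation the perturbation leaves \<open>S - \<alpha> \<epsilon> - \<beta> \<tau> / 3\<close> unchanged
  up to \<open>O(\<delta>\<^sup>2)\<close>. Maximality hence gives \<open>W(C) \<le> W\<^sub>0\<close> for all \<open>C\<close>. So almost all columns of \<open>g\<close> have
  the maximal worth \<open>W\<^sub>0\<close>, and the others are overwritten by a copy of a good one.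
\<close>

section \<open>Bounded functions and kernels on the unit interval\<close>

lemma space_unit_interval: "space unit_interval = {0..1}"
  by (simp add: space_restrict_space)

interpretation U: finite_measure unit_interval
  by (rule finite_measureI) (simp add: emeasure_restrict_space space_restrict_space)

lemma measure_unit_interval: "measure unit_interval (space unit_interval) = 1"
  by (simp add: measure_restrict_space space_restrict_space)

interpretation UU: pair_sigma_finite unit_interval unit_interval ..

interpretation P: finite_measure "unit_interval \<Otimes>\<^sub>M unit_interval"
  by (rule finite_measure_pair_measure) unfold_locales

text \<open>The bound holds at every point, not just almost everywhere, so that it passes to each
  single column of a kernel. On a finite measure it supplies the integrability that linearity and
  Fubini require.\<close>

definition bounded_function :: "(real \<Rightarrow> real) \<Rightarrow> bool" where
  "bounded_function f \<longleftrightarrow> f \<in> borel_measurable unit_interval \<and> (\<exists>B. \<forall>x\<in>{0..1}. \<bar>f x\<bar> \<le> B)"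

definition bounded_kernel :: "(real \<Rightarrow> real \<Rightarrow> real) \<Rightarrow> bool" where
  "bounded_kernel f \<longleftrightarrow>
     case_prod f \<in> borel_measurable (unit_interval \<Otimes>\<^sub>M unit_interval) \<and>
     (\<exists>B. \<forall>x\<in>{0..1}. \<forall>y\<in>{0..1}. \<bar>f x y\<bar> \<le> B)"

abbreviation dint :: "(real \<Rightarrow> real \<Rightarrow> real) \<Rightarrow> real" where
  "dint f \<equiv> LINT x|unit_interval. LINT y|unit_interval. f x y"

lemma bounded_function_measurable [measurable_dest]:
  "bounded_function f \<Longrightarrow> f \<in> borel_measurable unit_interval"
  by (simp add: bounded_function_def)

lemma bounded_kernel_measurable [measurable_dest]:
  "bounded_kernel f \<Longrightarrow> case_prod f \<in> borel_measurable (unit_interval \<Otimes>\<^sub>M unit_interval)"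
  by (simp add: bounded_kernel_def)

lemma bounded_kernelE:
  assumes "bounded_kernel f"
  obtains B where "0 \<le> B" "\<And>x y. x \<in> {0..1} \<Longrightarrow> y \<in> {0..1} \<Longrightarrow> \<bar>f x y\<bar> \<le> B"
proof -
  obtain B where B: "\<forall>x\<in>{0..1}. \<forall>y\<in>{0..1}. \<bar>f x y\<bar> \<le> B"
    using assms by (auto simp: bounded_kernel_def)
  then have "\<bar>f 0 0\<bar> \<le> B" by auto
  then have "0 \<le> B" by linarith
  then show ?thesis using B by (intro that[of B]) auto
qed

lemma bounded_functionE:
  assumes "bounded_function f"
  obtains B where "0 \<le> B" "\<And>x. x \<in> {0..1} \<Longrightarrow> \<bar>f x\<bar> \<le> B"
proof -
  obtain B where B: "\<forall>x\<in>{0..1}. \<bar>f x\<bar> \<le> B"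
    using assms by (auto simp: bounded_function_def)
  then have "\<bar>f 0\<bar> \<le> B" by auto
  then have "0 \<le> B" by linarith
  then show ?thesis using B by (intro that[of B]) auto
qed

lemma integrable_bounded_function [simp]: "bounded_function f \<Longrightarrow> integrable unit_interval f"
  by (auto simp: bounded_function_def space_unit_interval intro!: U.integrable_const_bound AE_I2)

lemma integrable_bounded_kernel [simp]:
  assumes "bounded_kernel f"
  shows "integrable (unit_interval \<Otimes>\<^sub>M unit_interval) (case_prod f)"
proof -
  obtain B where B: "\<And>x y. x \<in> {0..1} \<Longrightarrow> y \<in> {0..1} \<Longrightarrow> \<bar>f x y\<bar> \<le> B"
    using bounded_kernelE[OF assms] by metis
  show ?thesis
    by (rule P.integrable_const_bound[of _ B])
      (use assms B in \<open>auto simp: bounded_kernel_def space_unit_interval space_pair_measure intro!: AE_I2\<close>)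
qed

lemma bounded_function_const [simp]: "bounded_function (\<lambda>_. c)"
  by (auto simp: bounded_function_def)

lemma bounded_function_add:
  assumes "bounded_function f" "bounded_function g"
  shows "bounded_function (\<lambda>x. f x + g x)"
proof -
  note [measurable] = bounded_function_measurable[OF assms(1)] bounded_function_measurable[OF assms(2)]
  obtain A B where "\<And>x. x \<in> {0..1} \<Longrightarrow> \<bar>f x\<bar> \<le> A" "\<And>x. x \<in> {0..1} \<Longrightarrow> \<bar>g x\<bar> \<le> B"
    using bounded_functionE[OF assms(1)] bounded_functionE[OF assms(2)] by metis
  then have "\<forall>x\<in>{0..1}. \<bar>f x + g x\<bar> \<le> A + B"
    by (smt (verit) abs_triangle_ineq)
  then show ?thesis unfolding bounded_function_def by auto
qed

lemma bounded_function_mult: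
  assumes "bounded_function f" "bounded_function g"
  shows "bounded_function (\<lambda>x. f x * g x)"
proof -
  note [measurable] = bounded_function_measurable[OF assms(1)] bounded_function_measurable[OF assms(2)]
  obtain A B where "\<And>x. x \<in> {0..1} \<Longrightarrow> \<bar>f x\<bar> \<le> A" "\<And>x. x \<in> {0..1} \<Longrightarrow> \<bar>g x\<bar> \<le> B"
    using bounded_functionE[OF assms(1)] bounded_functionE[OF assms(2)] by metis
  then have "\<forall>x\<in>{0..1}. \<bar>f x * g x\<bar> \<le> A * B"
    unfolding abs_mult by (meson abs_ge_zero mult_mono order_trans)
  then show ?thesis unfolding bounded_function_def by auto
qed

lemma bounded_kernel_const [simp]: "bounded_kernel (\<lambda>_ _. c)"
  by (auto simp: bounded_kernel_def)

lemma bounded_kernel_add: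
  assumes "bounded_kernel f" "bounded_kernel g"
  shows "bounded_kernel (\<lambda>x y. f x y + g x y)"
proof -
  note [measurable] = bounded_kernel_measurable[OF assms(1)] bounded_kernel_measurable[OF assms(2)]
  obtain A B where "\<And>x y. x \<in> {0..1} \<Longrightarrow> y \<in> {0..1} \<Longrightarrow> \<bar>f x y\<bar> \<le> A"
    "\<And>x y. x \<in> {0..1} \<Longrightarrow> y \<in> {0..1} \<Longrightarrow> \<bar>g x y\<bar> \<le> B"
    using bounded_kernelE[OF assms(1)] bounded_kernelE[OF assms(2)] by metis
  then have "\<forall>x\<in>{0..1}. \<forall>y\<in>{0..1}. \<bar>f x y + g x y\<bar> \<le> A + B"
    by (smt (verit) abs_triangle_ineq)
  then show ?thesis unfolding bounded_kernel_def by auto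
qed

lemma bounded_kernel_mult:
  assumes "bounded_kernel f" "bounded_kernel g"
  shows "bounded_kernel (\<lambda>x y. f x y * g x y)"
proof -
  note [measurable] = bounded_kernel_measurable[OF assms(1)] bounded_kernel_measurable[OF assms(2)]
  obtain A B where "\<And>x y. x \<in> {0..1} \<Longrightarrow> y \<in> {0..1} \<Longrightarrow> \<bar>f x y\<bar> \<le> A"
    "\<And>x y. x \<in> {0..1} \<Longrightarrow> y \<in> {0..1} \<Longrightarrow> \<bar>g x y\<bar> \<le> B"
    using bounded_kernelE[OF assms(1)] bounded_kernelE[OF assms(2)] by metis
  then have "\<forall>x\<in>{0..1}. \<forall>y\<in>{0..1}. \<bar>f x y * g x y\<bar> \<le> A * B"
    unfolding abs_mult by (meson abs_ge_zero mult_mono order_trans)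
  then show ?thesis unfolding bounded_kernel_def by auto
qed

lemma bounded_kernel_swap:
  assumes "bounded_kernel f"
  shows "bounded_kernel (\<lambda>x y. f y x)"
proof -
  note [measurable] = bounded_kernel_measurable[OF assms]
  have "case_prod (\<lambda>x y. f y x) \<in> borel_measurable (unit_interval \<Otimes>\<^sub>M unit_interval)"
    by measurable
  then show ?thesis using assms unfolding bounded_kernel_def by blast
qed

lemma bounded_kernel_fst:
  assumes "bounded_function f" shows "bounded_kernel (\<lambda>x y. f x)"
proof -
  note [measurable] = bounded_function_measurable[OF assms]
  show ?thesis using assms by (auto simp: bounded_kernel_def bounded_function_def)
qed

lemma bounded_kernel_snd: "bounded_function f \<Longrightarrow> bounded_kernel (\<lambda>x y. f y)"
  using bounded_kernel_swap[OF bounded_kernel_fst] .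

lemma bounded_function_column:
  assumes "bounded_kernel f" "x \<in> {0..1}" shows "bounded_function (f x)"
proof -
  note [measurable] = bounded_kernel_measurable[OF assms(1)]
  have [measurable]: "x \<in> space unit_interval" using assms by (simp add: space_unit_interval)
  have "(\<lambda>y. f x y) \<in> borel_measurable unit_interval" by measurable
  then show ?thesis using assms unfolding bounded_function_def bounded_kernel_def by blast
qed

lemma integral_unit_interval_abs_le:
  fixes f :: "real \<Rightarrow> real"
  assumes "\<And>x. x \<in> {0..1} \<Longrightarrow> \<bar>f x\<bar> \<le> B"
  shows "\<bar>LINT x|unit_interval. f x\<bar> \<le> B"
proof (cases "integrable unit_interval f")
  case True
  have "\<bar>LINT x|unit_interval. f x\<bar> \<le> (LINT x|unit_interval. \<bar>f x\<bar>)"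
    by (rule integral_abs_bound)
  also have "\<dots> \<le> (LINT x|unit_interval. B)"
    using True assms by (intro integral_mono) (auto simp: space_unit_interval)
  finally show ?thesis using measure_unit_interval by simp
next
  \<comment> \<open>A nonintegrable function has integral 0 by convention, and the bound at the
    point 0 shows \<open>0 \<le> B\<close>.\<close>
  case False
  have "\<bar>f 0\<bar> \<le> B" using assms by simp
  then show ?thesis using False by (simp add: not_integrable_integral_eq)
qed

lemma bounded_kernel_compose:
  assumes "bounded_kernel f" "bounded_kernel g"
  shows "bounded_kernel (\<lambda>x y. LINT z|unit_interval. f y z * g z x)"
proof -
  note [measurable] = bounded_kernel_measurable[OF assms(1)] bounded_kernel_measurable[OF assms(2)]
  obtain A B where b: "\<And>x y. x \<in> {0..1} \<Longrightarrow> y \<in> {0..1} \<Longrightarrow> \<bar>f x y\<bar> \<le> A"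
    "\<And>x y. x \<in> {0..1} \<Longrightarrow> y \<in> {0..1} \<Longrightarrow> \<bar>g x y\<bar> \<le> B"
    using bounded_kernelE[OF assms(1)] bounded_kernelE[OF assms(2)] by metis
  have "\<bar>f y z * g z x\<bar> \<le> A * B" if "x \<in> {0..1}" "y \<in> {0..1}" "z \<in> {0..1}" for x y z
    using that unfolding abs_mult by (meson b abs_ge_zero mult_mono order_trans)
  then have "\<forall>x\<in>{0..1}. \<forall>y\<in>{0..1}. \<bar>LINT z|unit_interval. f y z * g z x\<bar> \<le> A * B"
    by (auto intro!: integral_unit_interval_abs_le)
  then show ?thesis unfolding bounded_kernel_def by auto
qed

lemma bounded_function_integral:
  assumes "bounded_kernel f"
  shows "bounded_function (\<lambda>x. LINT y|unit_interval. f x y)"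
proof -
  note [measurable] = bounded_kernel_measurable[OF assms(1)]
  obtain B where "\<And>x y. x \<in> {0..1} \<Longrightarrow> y \<in> {0..1} \<Longrightarrow> \<bar>f x y\<bar> \<le> B"
    using bounded_kernelE[OF assms(1)] by metis
  then have "\<forall>x\<in>{0..1}. \<bar>LINT y|unit_interval. f x y\<bar> \<le> B"
    by (auto intro!: integral_unit_interval_abs_le)
  then show ?thesis unfolding bounded_function_def by auto
qed

section \<open>Iterated integrals over the unit square\<close>

lemma dint_eq:
  assumes "bounded_kernel f"
  shows "dint f = (LINT p|(unit_interval \<Otimes>\<^sub>M unit_interval). case_prod f p)"
  using UU.integral_fst[OF integrable_bounded_kernel[OF assms]] by simp

lemma dint_swap:
  assumes "bounded_kernel f" shows "dint (\<lambda>x y. f y x) = dint f"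
  using UU.Fubini_integral[OF integrable_bounded_kernel[OF assms]] by simp

lemma dint_add:
  assumes "bounded_kernel f" "bounded_kernel g"
  shows "dint (\<lambda>x y. f x y + g x y) = dint f + dint g"
  using Bochner_Integration.integral_add[OF integrable_bounded_kernel[OF assms(1)]
      integrable_bounded_kernel[OF assms(2)]]
  unfolding dint_eq[OF assms(1)] dint_eq[OF assms(2)] dint_eq[OF bounded_kernel_add[OF assms]]
  by (simp add: case_prod_unfold)

lemma dint_const [simp]: "dint (\<lambda>x y. c) = c"
  using measure_unit_interval by simp

lemma dint_mono_AE:
  assumes "bounded_kernel f" "bounded_kernel g"
    "AE (x, y) in unit_interval \<Otimes>\<^sub>M unit_interval. f x y \<le> g x y"
  shows "dint f \<le> dint g"
  unfolding dint_eq[OF assms(1)] dint_eq[OF assms(2)]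
  using assms by (intro integral_mono_AE integrable_bounded_kernel) (simp_all add: case_prod_unfold)

lemma dint_cong_AE:
  assumes "bounded_kernel f" "bounded_kernel g"
    "AE (x, y) in unit_interval \<Otimes>\<^sub>M unit_interval. f x y = g x y"
  shows "dint f = dint g"
  unfolding dint_eq[OF assms(1)] dint_eq[OF assms(2)]
  using assms by (intro integral_cong_AE) (auto simp: case_prod_unfold bounded_kernel_def)

lemma dint_cong:
  assumes "\<And>x y. x \<in> {0..1} \<Longrightarrow> y \<in> {0..1} \<Longrightarrow> f x y = g x y"
  shows "dint f = dint g"
  using assms by (intro Bochner_Integration.integral_cong) (auto simp: space_unit_interval)

lemma dint_abs_le:
  assumes "\<And>x y. x \<in> {0..1} \<Longrightarrow> y \<in> {0..1} \<Longrightarrow> \<bar>f x y\<bar> \<le> B"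
  shows "\<bar>dint f\<bar> \<le> B"
  using assms by (intro integral_unit_interval_abs_le)

section \<open>The triangle density as a trilinear form\<close>

definition trilin :: "(real \<Rightarrow> real \<Rightarrow> real) \<Rightarrow> (real \<Rightarrow> real \<Rightarrow> real) \<Rightarrow> (real \<Rightarrow> real \<Rightarrow> real) \<Rightarrow> real" where
  "trilin f g h = (LINT x|unit_interval. LINT y|unit_interval. LINT z|unit_interval. f x y * g y z * h z x)"

lemma triangle_density_eq_trilin: "triangle_density f = trilin f f f"
  by (simp add: triangle_density_def trilin_def)

lemma trilin_eq_dint: "trilin f g h = dint (\<lambda>x y. f x y * (LINT z|unit_interval. g y z * h z x))"
  by (simp add: trilin_def mult.assoc)

lemma trilin_add:
  assumes "bounded_kernel f" "bounded_kernel f'" "bounded_kernel g" "bounded_kernel h"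
  shows "trilin (\<lambda>x y. f x y + f' x y) g h = trilin f g h + trilin f' g h"
  unfolding trilin_eq_dint distrib_right
  by (intro dint_add bounded_kernel_mult bounded_kernel_compose assms)

lemma trilin_cmult: "trilin (\<lambda>x y. c * f x y) g h = c * trilin f g h"
  unfolding trilin_eq_dint by (simp add: mult.assoc)

text \<open>Two exchanges of the order of integration, first of x and y, then of x and z for fixed
  y, bring y to the front. Linearity in the first slot thereby passes to the other two.\<close>

lemma trilin_cyclic:
  assumes "bounded_kernel f" "bounded_kernel g" "bounded_kernel h"
  shows "trilin f g h = trilin g h f"
proof -
  have "trilin f g h = dint (\<lambda>x y. f x y * (LINT z|unit_interval. g y z * h z x))"
    by (rule trilin_eq_dint)
  also have "\<dots> = dint (\<lambda>y x. f x y * (LINT z|unit_interval. g y z * h z x))"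
    using dint_swap[OF bounded_kernel_mult[OF assms(1) bounded_kernel_compose[OF assms(2,3)]]] by simp
  also have "\<dots> = (LINT y|unit_interval. LINT x|unit_interval. LINT z|unit_interval. f x y * g y z * h z x)"
    by (simp add: mult.assoc)
  also have "\<dots> = (LINT y|unit_interval. LINT z|unit_interval. LINT x|unit_interval. f x y * g y z * h z x)"
  proof (rule Bochner_Integration.integral_cong[OF refl])
    fix y assume "y \<in> space unit_interval"
    then have y: "y \<in> {0..1}" by (simp add: space_unit_interval)
    have "bounded_kernel (\<lambda>x z. f x y * g y z * h z x)"
      by (intro bounded_kernel_mult bounded_kernel_swap[OF assms(3)] bounded_kernel_fst[of "\<lambda>x. f x y"]
          bounded_kernel_snd[of "g y"] bounded_function_column[OF assms(2) y]
          bounded_function_column[OF bounded_kernel_swap[OF assms(1)] y])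
    from dint_swap[OF this]
    show "dint (\<lambda>x z. f x y * g y z * h z x) = dint (\<lambda>z x. f x y * g y z * h z x)" by simp
  qed
  also have "\<dots> = trilin g h f"
    by (simp add: trilin_def mult.commute mult.left_commute)
  finally show ?thesis .
qed

lemma trilin_abs_le:
  assumes "\<And>x y. x \<in> {0..1} \<Longrightarrow> y \<in> {0..1} \<Longrightarrow> \<bar>f x y\<bar> \<le> A"
    "\<And>x y. x \<in> {0..1} \<Longrightarrow> y \<in> {0..1} \<Longrightarrow> \<bar>g x y\<bar> \<le> B"
    "\<And>x y. x \<in> {0..1} \<Longrightarrow> y \<in> {0..1} \<Longrightarrow> \<bar>h x y\<bar> \<le> C"
  shows "\<bar>trilin f g h\<bar> \<le> A * B * C"
  unfolding trilin_def
proof (intro integral_unit_interval_abs_le)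
  fix x y z :: real assume a: "x \<in> {0..1}" "y \<in> {0..1}" "z \<in> {0..1}"
  have f: "\<bar>f x y\<bar> \<le> A" and g: "\<bar>g y z\<bar> \<le> B" and h: "\<bar>h z x\<bar> \<le> C"
    by (rule assms; rule a)+
  have "0 \<le> A" "0 \<le> B" using f g by linarith+
  then have "\<bar>f x y\<bar> * \<bar>g y z\<bar> * \<bar>h z x\<bar> \<le> A * B * C"
    by (intro mult_mono f g h mult_nonneg_nonneg abs_ge_zero)
  then show "\<bar>f x y * g y z * h z x\<bar> \<le> A * B * C" by (simp add: abs_mult)
qed

text \<open>Of the eight terms of the trilinear expansion, those with equally many factors
  \<open>f\<close> are cyclic shifts of one another. The formula serves twice: with coefficient 1 it
  linearizes the triangle density, and as a cubic polynomial in \<open>b\<close> it gives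
  continuity.\<close>

lemma triangle_density_add_cmult:
  assumes "bounded_kernel k" "bounded_kernel f"
  shows "triangle_density (\<lambda>x y. k x y + b * f x y) =
    triangle_density k + 3 * b * trilin f k k + 3 * b^2 * trilin f f k + b^3 * trilin f f f"
proof -
  define bf where "bf = (\<lambda>x y. b * f x y)"
  have K[simp]: "bounded_kernel bf" unfolding bf_def
    by (intro bounded_kernel_mult bounded_kernel_const assms)
  define s where "s = (\<lambda>x y. k x y + bf x y)"
  have Ks[simp]: "bounded_kernel s" unfolding s_def by (intro bounded_kernel_add assms K)
  note [simp] = assms
  have add: "trilin s u v = trilin k u v + trilin bf u v" if "bounded_kernel u" "bounded_kernel v" for u v
    unfolding s_def by (rule trilin_add) (use that in auto)
  have add2: "trilin u s v = trilin u k v + trilin u bf v" if "bounded_kernel u" "bounded_kernel v" for u v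
    using that add[of v u] trilin_cyclic[of u s v] trilin_cyclic[of u k v] trilin_cyclic[of u bf v] by simp
  have add3: "trilin u v s = trilin u v k + trilin u v bf" if "bounded_kernel u" "bounded_kernel v" for u v
    using that add2[of v u] trilin_cyclic[of u v s] trilin_cyclic[of u v k] trilin_cyclic[of u v bf] by simp
  have c1: "trilin bf u v = b * trilin f u v" for u v
    unfolding bf_def by (rule trilin_cmult)
  have c2: "trilin u bf v = b * trilin u f v" if "bounded_kernel u" "bounded_kernel v" for u v
    using that c1[of v u] trilin_cyclic[of u bf v] trilin_cyclic[of u f v] by simp
  have c3: "trilin u v bf = b * trilin u v f" if "bounded_kernel u" "bounded_kernel v" for u v
    using that c1[of u v] trilin_cyclic[of bf u v] trilin_cyclic[of f u v] by simp
  have y: "trilin k f k = trilin f k k" "trilin k k f = trilin f k k"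
    "trilin f k f = trilin f f k" "trilin k f f = trilin f f k"
    using trilin_cyclic[of k f k] trilin_cyclic[of f k k] trilin_cyclic[of k f f] trilin_cyclic[of f k f]
    by simp_all
  have "triangle_density (\<lambda>x y. k x y + b * f x y) = trilin s s s"
    by (simp add: triangle_density_eq_trilin s_def bf_def)
  also have "\<dots> = triangle_density k + 3 * b * trilin f k k + 3 * b^2 * trilin f f k + b^3 * trilin f f f"
    by (simp add: add add2 add3 c1 c2 c3 y triangle_density_eq_trilin power2_eq_square power3_eq_cube algebra_simps)
  finally show ?thesis .
qed

section \<open>Adjoining a vertex class\<close>

lemma bounded_function_cong:
  "(\<And>x. x \<in> {0..1} \<Longrightarrow> f x = g x) \<Longrightarrow> bounded_function f \<longleftrightarrow> bounded_function g"
  unfolding bounded_function_def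
  by (intro conj_cong measurable_cong) (auto simp: space_unit_interval)

lemma bounded_function_cmult: "bounded_function f \<Longrightarrow> bounded_function (\<lambda>x. c * f x)"
  by (intro bounded_function_mult bounded_function_const)

lemma integral_unit_interval_cong:
  "(\<And>x. x \<in> {0..1} \<Longrightarrow> f x = g x) \<Longrightarrow> (LINT x|unit_interval. f x) = (LINT x|unit_interval. g x)"
  by (intro Bochner_Integration.integral_cong) (auto simp: space_unit_interval)

text \<open>The value \<open>2\<close> stands for a single new vertex outside the unit interval; it receives mass
  \<open>1 - s\<close>, and the unit interval is shrunk to mass \<open>s\<close>.\<close>

definition rescale :: "real \<Rightarrow> real \<Rightarrow> real" where
  "rescale s x = (if x < s then x / s else 2)"

lemma rescale_mem: "0 < s \<Longrightarrow> x \<in> {0..1} \<Longrightarrow> rescale s x \<in> {0..1} \<union> {2}"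
  by (auto simp: rescale_def)

text \<open>The image of Lebesgue measure under \<open>rescale s\<close> is \<open>s\<close> times
  Lebesgue measure on the unit interval plus an atom of mass \<open>1 - s\<close> at 2. An affine
  substitution handles the first piece; on the rest \<open>rescale s\<close> is constant.\<close>

lemma integral_rescale:
  assumes s: "0 < s" "s < 1" and F: "bounded_function F"
  shows "(LINT x|unit_interval. F (rescale s x)) = s * (LINT x|unit_interval. F x) + (1 - s) * F 2"
proof -
  define f where "f = (\<lambda>x. indicator {0..<s} x * F (x / s))"
  have i0: "integrable lborel (\<lambda>x. indicator {0..1} x * F x)"
    using integrable_bounded_function[OF F] by (simp add: integrable_restrict_space)
  \<comment> \<open>Since \<open>rescale s\<close> sends \<open>s\<close> itself to the new vertex,
    the substitution sees only the half-open interval. Dropping the point 1 changes nothing almost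
    everywhere.\<close>
  have ae: "AE x in lborel. indicator {0..1} x * F x = indicator {0..<1} x * F x"
    using AE_lborel_singleton[of 1] by eventually_elim (auto simp: indicator_def)
  have f_eq: "f (0 + s * x) = indicator {0..<1} x * F x" for x
    using s by (auto simp: f_def indicator_def zero_le_mult_iff)
  have "(\<lambda>x. indicator {0..1} x * F x * indicator {0..<1} x) \<in> borel_measurable lborel"
    using borel_measurable_integrable[OF i0] by (rule borel_measurable_times) simp_all
  also have "(\<lambda>x. indicator {0..1} x * F x * indicator {0..<1} x) = (\<lambda>x. indicator {0..<1} x * F x)"
    by (auto simp: indicator_def fun_eq_iff)
  finally have m: "(\<lambda>x. indicator {0..<1} x * F x) \<in> borel_measurable lborel" .
  have i1: "integrable lborel (\<lambda>x. indicator {0..<1} x * F x)"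
    using i0 integrable_cong_AE[OF _ m ae] by auto
  then have i2: "integrable lborel f"
    using lborel_integrable_real_affine_iff[of s f 0] s unfolding f_eq by simp
  have "(LINT x|lborel. f x) = s * (LINT x|lborel. indicator {0..<1} x * F x)"
    using lborel_integral_real_affine[of s f 0] s unfolding f_eq by simp
  also have "(LINT x|lborel. indicator {0..<1} x * F x) = (LINT x|lborel. indicator {0..1} x * F x)"
    using i0 m ae by (intro integral_cong_AE) auto
  also have "\<dots> = (LINT x|unit_interval. F x)"
    by (simp add: integral_restrict_space)
  finally have "(LINT x|lborel. f x) = s * (LINT x|unit_interval. F x)" .
  moreover have "(LINT x|unit_interval. F (rescale s x)) = (LINT x|lborel. f x + indicator {s..1} x * F 2)"
    using s by (subst integral_restrict_space, simp, intro Bochner_Integration.integral_cong) (auto simp: f_def rescale_def indicator_def)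
  moreover have "\<dots> = (LINT x|lborel. f x) + (LINT x|lborel. indicator {s..1} x * F 2)"
    using s i2 by (intro Bochner_Integration.integral_add) auto
  moreover have "(LINT x|lborel. indicator {s..1} x * F 2) = (1 - s) * F 2"
    using s by simp
  ultimately show ?thesis by simp
qed

text \<open>The value 0 at the pair (2, 2) keeps the new class free of inner edges. Its block, whose
  mass is of second order, then contributes nothing to edges, to triangles or, since
  \<open>H 0 = 0\<close>, to entropy.\<close>

definition adjoin :: "(real \<Rightarrow> real \<Rightarrow> real) \<Rightarrow> (real \<Rightarrow> real) \<Rightarrow> real \<Rightarrow> real \<Rightarrow> real" where
  "adjoin k C x y = (if x = 2 then if y = 2 then 0 else C y else if y = 2 then C x else k x y)"

definition blowup :: "real \<Rightarrow> (real \<Rightarrow> real \<Rightarrow> real) \<Rightarrow> (real \<Rightarrow> real) \<Rightarrow> real \<Rightarrow> real \<Rightarrow> real" where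
  "blowup s k C x y = adjoin k C (rescale s x) (rescale s y)"

lemma adjoin_simps:
  "x \<in> {0..1} \<Longrightarrow> y \<in> {0..1} \<Longrightarrow> adjoin k C x y = k x y"
  "x \<in> {0..1} \<Longrightarrow> adjoin k C x 2 = C x"
  "y \<in> {0..1} \<Longrightarrow> adjoin k C 2 y = C y"
  "adjoin k C 2 2 = 0"
  by (auto simp: adjoin_def)

lemma bounded_function_adjoin:
  assumes "bounded_kernel k" "bounded_function C" "u \<in> {0..1} \<union> {2}"
  shows "bounded_function (adjoin k C u)"
proof (cases "u = 2")
  case True
  then have "bounded_function (adjoin k C u) \<longleftrightarrow> bounded_function C"
    by (intro bounded_function_cong) (auto simp: adjoin_simps)
  then show ?thesis using assms by simp
next
  case False
  then have "bounded_function (adjoin k C u) \<longleftrightarrow> bounded_function (k u)"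
    using assms by (intro bounded_function_cong) (auto simp: adjoin_simps)
  then show ?thesis using False assms bounded_function_column by auto
qed

lemma bounded_function_adjoin':
  assumes "bounded_kernel k" "bounded_function C" "u \<in> {0..1} \<union> {2}"
  shows "bounded_function (\<lambda>x. adjoin k C x u)"
proof -
  have "(\<lambda>x. adjoin k C x u) = adjoin (\<lambda>x y. k y x) C u"
    by (auto simp: adjoin_def fun_eq_iff)
  then show ?thesis
    using bounded_function_adjoin[OF bounded_kernel_swap[OF assms(1)] assms(2,3)] by simp
qed

text \<open>The variables are integrated out in turn with \<open>integral_rescale\<close>; the row
  and the column of the new vertex both carry \<open>C\<close>, hence the factor 2. The formula
  covers arbitrary bounded kernels because it also computes the entropy, from \<open>H\<close> of
  the kernel and \<open>H\<close> of the column.\<close>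

lemma dint_blowup:
  assumes s: "0 < s" "s < 1" and k: "bounded_kernel k" and C: "bounded_function C"
  shows "dint (blowup s k C) = s^2 * dint k + 2 * s * (1 - s) * (LINT y|unit_interval. C y)"
proof -
  define F where "F = (\<lambda>u. s * (LINT y|unit_interval. adjoin k C u y) + (1 - s) * adjoin k C u 2)"
  have F: "F u = s * (LINT y|unit_interval. k u y) + (1 - s) * C u" if "u \<in> {0..1}" for u
    using that unfolding F_def
    by (intro arg_cong2[where f="(+)"] arg_cong2[where f="(*)"] integral_unit_interval_cong)
       (auto simp: adjoin_simps)
  have F2: "F 2 = s * (LINT y|unit_interval. C y)"
    unfolding F_def adjoin_simps
    by (simp, intro disjI2 integral_unit_interval_cong) (auto simp: adjoin_simps)
  have b1: "bounded_function (\<lambda>u. s * (LINT y|unit_interval. k u y))"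
    by (intro bounded_function_cmult bounded_function_integral k)
  have b2: "bounded_function (\<lambda>u. (1 - s) * C u)"
    by (intro bounded_function_cmult C)
  have bF: "bounded_function F"
    using bounded_function_add[OF b1 b2] bounded_function_cong[OF F] by auto
  have "dint (blowup s k C) = (LINT x|unit_interval. F (rescale s x))"
  proof (rule integral_unit_interval_cong)
    fix x :: real assume "x \<in> {0..1}"
    from integral_rescale[OF s bounded_function_adjoin[OF k C rescale_mem[OF s(1) this]]]
    show "(LINT y|unit_interval. blowup s k C x y) = F (rescale s x)"
      by (simp add: blowup_def F_def)
  qed
  also have "\<dots> = s * (LINT x|unit_interval. F x) + (1 - s) * F 2"
    by (rule integral_rescale[OF s bF])
  also have "(LINT x|unit_interval. F x) =
      (LINT x|unit_interval. s * (LINT y|unit_interval. k x y) + (1 - s) * C x)"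
    by (rule integral_unit_interval_cong) (rule F)
  also have "\<dots> = s * dint k + (1 - s) * (LINT x|unit_interval. C x)"
    by (subst Bochner_Integration.integral_add[OF b1[THEN integrable_bounded_function]
          b2[THEN integrable_bounded_function]]) simp
  finally show ?thesis unfolding F2 by (simp add: algebra_simps power2_eq_square)
qed

text \<open>The density of triangles through a vertex whose column is \<open>C\<close>; it is the
  quadratic part of the worth.\<close>

definition column_form :: "(real \<Rightarrow> real \<Rightarrow> real) \<Rightarrow> (real \<Rightarrow> real) \<Rightarrow> real" where
  "column_form k C = dint (\<lambda>y z. C y * C z * k y z)"

text \<open>Triangles with no vertex in the new class have weight \<open>s^3\<close>. A single
  vertex in the class can take three positions, each of weight \<open>s^2 * (1 - s)\<close>, and
  symmetry of \<open>k\<close> gives them the same form. Two vertices in the class would need an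
  edge inside it, where the kernel is 0.\<close>

lemma triangle_density_blowup:
  assumes s: "0 < s" "s < 1" and k: "bounded_kernel k" and C: "bounded_function C"
    and sym: "\<And>x y. x \<in> {0..1} \<Longrightarrow> y \<in> {0..1} \<Longrightarrow> k x y = k y x"
  shows "triangle_density (blowup s k C) = s^3 * triangle_density k + 3 * s^2 * (1 - s) * column_form k C"
proof -
  let ?E = "adjoin k C" and ?I = "{0..1} \<union> {2::real}"
  \<comment> \<open>\<open>F2\<close> and \<open>F3\<close> arise by integrating out the third and
    then the second vertex; the remaining vertices may be old points or 2.\<close>
  define F2 where "F2 = (\<lambda>u v. s * (LINT w|unit_interval. ?E u v * ?E v w * ?E w u) +
      (1 - s) * (?E u v * ?E v 2 * ?E 2 u))"
  define F3 where "F3 = (\<lambda>u. s * (LINT v|unit_interval. F2 u v) + (1 - s) * F2 u 2)"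
  have F2_I: "F2 u v = s * (LINT w|unit_interval. k u v * k v w * k w u) + (1 - s) * (C u * C v * k u v)"
    if "u \<in> {0..1}" "v \<in> {0..1}" for u v
    using that unfolding F2_def
    by (intro arg_cong2[where f="(+)"] arg_cong2[where f="(*)" and a="1 - s"]
          arg_cong2[where f="(*)" and a=s] integral_unit_interval_cong)
       (auto simp: adjoin_simps ac_simps)
  have F2_2: "F2 2 v = s * (LINT w|unit_interval. C v * C w * k v w)"
    if "v \<in> {0..1}" for v
    using that unfolding F2_def
    by (simp add: adjoin_simps, intro disjI2 integral_unit_interval_cong) (auto simp: adjoin_simps)
  have F2_2': "F2 u 2 = s * (LINT w|unit_interval. C u * C w * k u w)"
    if "u \<in> {0..1}" for u
    using that unfolding F2_def
    by (simp add: adjoin_simps, intro disjI2 integral_unit_interval_cong) (auto simp: adjoin_simps sym)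
  have F2_22: "F2 2 2 = 0" unfolding F2_def by (simp add: adjoin_simps)
  have ct: "bounded_kernel (\<lambda>u v. LINT w|unit_interval. k u v * k v w * k w u)"
    using bounded_kernel_mult[OF k bounded_kernel_compose[OF k k]] by (simp add: mult.assoc)
  have cC: "bounded_kernel (\<lambda>u v. C u * C v * k u v)"
    by (intro bounded_kernel_mult k bounded_kernel_fst bounded_kernel_snd C)
  have cF2: "bounded_kernel (\<lambda>u v. s * (LINT w|unit_interval. k u v * k v w * k w u) + (1 - s) * (C u * C v * k u v))"
    by (intro bounded_kernel_add bounded_kernel_mult[OF bounded_kernel_const] ct cC)
  have cC': "bounded_function (\<lambda>u. s * (LINT w|unit_interval. C u * C w * k u w))"
    by (intro bounded_function_cmult bounded_function_integral cC)
  have bF2: "bounded_function (F2 u)" if "u \<in> ?I" for u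
  proof (cases "u = 2")
    case True
    then show ?thesis using cC' bounded_function_cong[OF F2_2] by simp
  next
    case False
    then have u: "u \<in> {0..1}" using that by simp
    show ?thesis
      using bounded_function_column[OF cF2 u] bounded_function_cong[OF F2_I[OF u]] by simp
  qed
  have F3_I: "F3 u = s * (LINT v|unit_interval. s * (LINT w|unit_interval. k u v * k v w * k w u)
      + (1 - s) * (C u * C v * k u v)) + (1 - s) * (s * (LINT w|unit_interval. C u * C w * k u w))"
    if "u \<in> {0..1}" for u
    using that unfolding F3_def
    by (intro arg_cong2[where f="(+)"] arg_cong2[where f="(*)"] integral_unit_interval_cong)
       (auto simp: F2_I F2_2')
  have bF3_1: "bounded_function (\<lambda>u. s * (LINT v|unit_interval. s * (LINT w|unit_interval. k u v * k v w * k w u)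
      + (1 - s) * (C u * C v * k u v)))"
    by (intro bounded_function_cmult bounded_function_integral cF2)
  have bF3_2: "bounded_function (\<lambda>u. (1 - s) * (s * (LINT w|unit_interval. C u * C w * k u w)))"
    by (intro bounded_function_cmult cC')
  have bF3: "bounded_function F3"
    using bounded_function_add[OF bF3_1 bF3_2] bounded_function_cong[OF F3_I] by auto
  have "F3 2 = s * (LINT v|unit_interval. s * (LINT w|unit_interval. C v * C w * k v w))"
    unfolding F3_def F2_22 by (simp, intro disjI2 trans[OF integral_unit_interval_cong[OF F2_2]]) auto
  then have F3_2: "F3 2 = s * (s * column_form k C)"
    by (simp add: column_form_def)
  have "triangle_density (blowup s k C) = (LINT x|unit_interval. F3 (rescale s x))"
    unfolding triangle_density_def
  proof (rule integral_unit_interval_cong)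
    fix x :: real assume "x \<in> {0..1}"
    then have x: "rescale s x \<in> ?I" using s rescale_mem by blast
    have "(LINT y|unit_interval. LINT z|unit_interval. blowup s k C x y * blowup s k C y z * blowup s k C z x) =
      (LINT y|unit_interval. F2 (rescale s x) (rescale s y))"
    proof (rule integral_unit_interval_cong)
      fix y :: real assume "y \<in> {0..1}"
      then have y: "rescale s y \<in> ?I" using s rescale_mem by blast
      have "bounded_function (\<lambda>w. ?E (rescale s x) (rescale s y) * ?E (rescale s y) w * ?E w (rescale s x))"
        by (intro bounded_function_mult bounded_function_const bounded_function_adjoin bounded_function_adjoin' k C x y)
      from integral_rescale[OF s this]
      show "(LINT z|unit_interval. blowup s k C x y * blowup s k C y z * blowup s k C z x) =
          F2 (rescale s x) (rescale s y)"
        by (simp add: blowup_def F2_def)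
    qed
    also have "\<dots> = F3 (rescale s x)"
      unfolding F3_def by (rule integral_rescale[OF s bF2[OF x]])
    finally show "(LINT y|unit_interval. LINT z|unit_interval. blowup s k C x y * blowup s k C y z * blowup s k C z x) =
      F3 (rescale s x)" .
  qed
  also have "\<dots> = s * (LINT u|unit_interval. F3 u) + (1 - s) * F3 2"
    by (rule integral_rescale[OF s bF3])
  also have "(LINT u|unit_interval. F3 u) = s * dint (\<lambda>u v. s * (LINT w|unit_interval. k u v * k v w * k w u)
      + (1 - s) * (C u * C v * k u v)) + (1 - s) * (s * column_form k C)"
    by (subst integral_unit_interval_cong[OF F3_I], assumption, subst Bochner_Integration.integral_add[OF bF3_1[THEN integrable_bounded_function]
          bF3_2[THEN integrable_bounded_function]]) (simp add: column_form_def)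
  also have "dint (\<lambda>u v. s * (LINT w|unit_interval. k u v * k v w * k w u)
      + (1 - s) * (C u * C v * k u v)) = s * triangle_density k + (1 - s) * column_form k C"
    using ct cC by (subst dint_add) (auto intro!: bounded_kernel_mult[OF bounded_kernel_const]
        simp: triangle_density_def column_form_def)
  finally show ?thesis
    unfolding F3_2 by (simp add: algebra_simps power2_eq_square power3_eq_cube)
qed

section \<open>Entropy, graphons and the blow-up\<close>

lemma H_0 [simp]: "H 0 = 0" by (simp add: H_def)

lemma H_measurable [measurable]: "H \<in> borel_measurable borel"
  unfolding H_def[abs_def] by measurable

text \<open>Composition with \<open>H\<close> preserves the zero block because
  \<open>H 0 = 0\<close>. Hence \<open>dint_blowup\<close> yields the entropy of a blow-up.\<close>

lemma H_blowup: "H (blowup s k C x y) = blowup s (\<lambda>x y. H (k x y)) (\<lambda>y. H (C y)) x y"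
  by (simp add: blowup_def adjoin_def)

lemma H_bounds:
  assumes "u \<in> {0..1}" shows "0 \<le> H u" "H u \<le> 2"
proof -
  \<comment> \<open>Each of the two summands of \<open>H\<close> lies in [0, 1]; the upper bound is
    ln (1/u) \<le> 1/u - 1.\<close>
  have *: "0 \<le> - (u * ln u) \<and> - (u * ln u) \<le> 1" if "u \<in> {0..1}" for u :: real
  proof (cases "u = 0")
    case False
    then have u: "0 < u" "u \<le> 1" using that by auto
    have "u * (- ln u) \<le> u * (1 / u - 1)"
      using u ln_le_minus_one[of "1 / u"] by (intro mult_left_mono) (auto simp: ln_div)
    then have "- (u * ln u) \<le> 1 - u" using u by (simp add: right_diff_distrib)
    then show ?thesis using u by (auto simp: mult_nonneg_nonpos)
  qed simp
  from *[of u] *[of "1 - u"] assms show "0 \<le> H u" "H u \<le> 2"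
    by (auto simp: H_def)
qed

lemma graphon_bounded_kernel: "graphon g \<Longrightarrow> bounded_kernel g"
  unfolding graphon_def bounded_kernel_def by (auto intro!: exI[of _ 1])

lemma graphon_sym: "graphon g \<Longrightarrow> x \<in> {0..1} \<Longrightarrow> y \<in> {0..1} \<Longrightarrow> g x y = g y x"
  unfolding graphon_def by blast

lemma graphon_mem: "graphon g \<Longrightarrow> x \<in> {0..1} \<Longrightarrow> y \<in> {0..1} \<Longrightarrow> g x y \<in> {0..1}"
  unfolding graphon_def by blast

lemma unit_function_bounded_function: "unit_function C \<Longrightarrow> bounded_function C"
  unfolding unit_function_def bounded_function_def by (auto intro!: exI[of _ 1])

lemma bounded_kernel_H:
  assumes "graphon g" shows "bounded_kernel (\<lambda>x y. H (g x y))"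
proof -
  note [measurable] = bounded_kernel_measurable[OF graphon_bounded_kernel[OF assms]]
  have "\<bar>H (g x y)\<bar> \<le> 2" if "x \<in> {0..1}" "y \<in> {0..1}" for x y
    using H_bounds[OF graphon_mem[OF assms that]] by auto
  then show ?thesis by (auto simp: bounded_kernel_def intro!: exI[of _ 2])
qed

lemma bounded_function_H:
  assumes "unit_function C" shows "bounded_function (\<lambda>y. H (C y))"
proof -
  note [measurable] = bounded_function_measurable[OF unit_function_bounded_function[OF assms]]
  have "\<bar>H (C y)\<bar> \<le> 2" if "y \<in> {0..1}" for y
    using H_bounds[of "C y"] assms that by (auto simp: unit_function_def)
  then show ?thesis by (auto simp: bounded_function_def intro!: exI[of _ 2])
qed

lemma graphon_blowup:
  assumes s: "0 < s" "s < 1" and k: "graphon k" and C: "unit_function C"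
  shows "graphon (blowup s k C)"
proof -
  \<comment> \<open>\<open>r\<close> has the dummy value 0 where \<open>rescale\<close> is 2, so
    that it maps the unit interval to itself and composes measurably with \<open>k\<close> and
    \<open>C\<close>. The formula \<open>eq\<close> reads \<open>r x\<close> only for
    \<open>x < s\<close>.\<close>
  define r where "r = (\<lambda>x. if x < s then x / s else 0)"
  have r: "r x \<in> {0..1}" if "x \<in> {0..1}" for x
    using s that by (auto simp: r_def)
  have [measurable]: "(\<lambda>x. x) \<in> borel_measurable unit_interval"
    by (rule measurable_restrict_space1) simp
  have [measurable]: "r \<in> measurable unit_interval unit_interval"
    unfolding measurable_restrict_space2_iff using r
    by (auto simp: space_unit_interval r_def)
  note [measurable] = bounded_kernel_measurable[OF graphon_bounded_kernel[OF k]]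
    bounded_function_measurable[OF unit_function_bounded_function[OF C]]
  have eq: "blowup s k C x y = (if x < s then if y < s then k (r x) (r y) else C (r x)
      else if y < s then C (r y) else 0)" if "x \<in> {0..1}" "y \<in> {0..1}" for x y
  proof -
    have "x < s \<Longrightarrow> x / s \<noteq> 2" for x using s by (auto simp: field_simps)
    then show ?thesis by (auto simp: blowup_def adjoin_def rescale_def r_def)
  qed
  have "case_prod (blowup s k C) \<in> borel_measurable (unit_interval \<Otimes>\<^sub>M unit_interval) \<longleftrightarrow>
    (\<lambda>(x, y). if x < s then if y < s then k (r x) (r y) else C (r x)
      else if y < s then C (r y) else 0) \<in> borel_measurable (unit_interval \<Otimes>\<^sub>M unit_interval)"
    by (rule measurable_cong) (auto simp: space_pair_measure space_unit_interval eq)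
  moreover have "(\<lambda>(x, y). if x < s then if y < s then k (r x) (r y) else C (r x)
      else if y < s then C (r y) else 0) \<in> borel_measurable (unit_interval \<Otimes>\<^sub>M unit_interval)"
    by measurable
  ultimately have "case_prod (blowup s k C) \<in> borel_measurable (unit_interval \<Otimes>\<^sub>M unit_interval)"
    by simp
  moreover have "blowup s k C x y \<in> {0..1} \<and> blowup s k C x y = blowup s k C y x"
    if "x \<in> {0..1}" "y \<in> {0..1}" for x y
    using graphon_mem[OF k r r, OF that] graphon_sym[OF k r r, OF that] C r that
    by (auto simp: eq unit_function_def)
  ultimately show ?thesis unfolding graphon_def by blast
qed

section \<open>First-order expansions\<close>

text \<open>The inequality ln t \<le> t - 1 at t = (p + q) / p bounds p ln p after a step q by its
  tangent plus \<open>q^2 / p\<close>. The cases p = g, q = f and p = 1 - g, q = - f contribute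
  \<open>1 / \<eta>\<close> each.\<close>

lemma H_ge_tangent:
  assumes g: "0 < \<eta>" "g \<in> {\<eta>..1-\<eta>}" and u: "0 < g + f" "g + f < 1"
  shows "H g + ln ((1 - g) / g) * f - 2 / \<eta> * f^2 \<le> H (g + f)"
proof -
  have aux: "(p + q) * ln (p + q) - p * ln p - (ln p + 1) * q \<le> 1 / \<eta> * q^2"
    if "\<eta> \<le> p" "0 < p + q" for p q :: real
  proof -
    have p: "0 < p" using that g by simp
    have "(p + q) * ln ((p + q) / p) \<le> (p + q) * ((p + q) / p - 1)"
      using p that by (intro mult_left_mono ln_le_minus_one) auto
    also have "\<dots> = q + q^2 / p"
      using p by (simp add: field_simps power2_eq_square)
    also have "q^2 / p \<le> q^2 / \<eta>"
      using that g by (intro divide_left_mono) auto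
    finally show ?thesis
      using p that by (simp add: ln_div algebra_simps)
  qed
  from aux[of g f] aux[of "1 - g" "- f"] g u
  have "(g + f) * ln (g + f) - g * ln g - (ln g + 1) * f \<le> 1 / \<eta> * f^2"
    "(1 - (g + f)) * ln (1 - (g + f)) - (1 - g) * ln (1 - g) + (ln (1 - g) + 1) * f \<le> 1 / \<eta> * f^2"
    by (auto simp: algebra_simps)
  then have "(g + f) * ln (g + f) - g * ln g - (ln g + 1) * f + ((1 - (g + f)) * ln (1 - (g + f)) - (1 - g) * ln (1 - g) + (ln (1 - g) + 1) * f) \<le> 2 / \<eta> * f^2"
    by simp
  moreover have ln: "ln ((1 - g) / g) = ln (1 - g) - ln g"
    using g by (simp add: ln_div)
  ultimately show ?thesis
    unfolding ln by (simp add: H_def algebra_simps)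
qed

lemma bounded_kernel_cong:
  "(\<And>x y. x \<in> {0..1} \<Longrightarrow> y \<in> {0..1} \<Longrightarrow> f x y = g x y) \<Longrightarrow> bounded_kernel f \<longleftrightarrow> bounded_kernel g"
  unfolding bounded_kernel_def
  by (intro conj_cong measurable_cong) (auto simp: space_unit_interval space_pair_measure)

lemma column_form_add_cmult:
  assumes "bounded_kernel k" "bounded_kernel f" "bounded_function C"
  shows "column_form (\<lambda>x y. k x y + b * f x y) C = column_form k C + b * column_form f C"
proof -
  have *: "bounded_kernel (\<lambda>x y. C x * C y * k x y)" "bounded_kernel (\<lambda>x y. b * (C x * C y * f x y))"
    by (intro bounded_kernel_mult bounded_kernel_const bounded_kernel_fst bounded_kernel_snd assms)+
  have "column_form (\<lambda>x y. k x y + b * f x y) C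
      = dint (\<lambda>x y. C x * C y * k x y + b * (C x * C y * f x y))"
    unfolding column_form_def by (simp add: algebra_simps)
  then show ?thesis
    unfolding dint_add[OF *] by (simp add: column_form_def)
qed

lemma column_form_abs_le:
  assumes "unit_function C" "\<And>x y. x \<in> {0..1} \<Longrightarrow> y \<in> {0..1} \<Longrightarrow> \<bar>k x y\<bar> \<le> B"
  shows "\<bar>column_form k C\<bar> \<le> B"
  unfolding column_form_def
proof (rule dint_abs_le)
  fix x y :: real assume a: "x \<in> {0..1}" "y \<in> {0..1}"
  then have C: "\<bar>C x\<bar> \<le> 1" "\<bar>C y\<bar> \<le> 1" using assms(1) by (auto simp: unit_function_def)
  have "\<bar>C x\<bar> * \<bar>C y\<bar> * \<bar>k x y\<bar> \<le> 1 * 1 * B"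
    by (intro mult_mono C assms(2) a) auto
  then show "\<bar>C x * C y * k x y\<bar> \<le> B" by (simp add: abs_mult)
qed

section \<open>Worth and codegree\<close>

lemma worth_eq_column_form:
  "worth g \<alpha> \<beta> C = 2 * (LINT y|unit_interval. H (C y)) - 2 * \<alpha> * (LINT y|unit_interval. C y)
     - \<beta> * column_form g C"
  by (simp add: worth_def column_form_def)

lemma bounded_kernel_codegree:
  assumes "graphon g" shows "bounded_kernel (codegree g)"
proof -
  have "codegree g x y = (LINT z|unit_interval. g y z * g z x)" if "x \<in> {0..1}" "y \<in> {0..1}" for x y
    unfolding codegree_def using that
    by (intro integral_unit_interval_cong) (simp add: graphon_sym[OF assms])
  then have "bounded_kernel (codegree g) \<longleftrightarrow> bounded_kernel (\<lambda>x y. LINT z|unit_interval. g y z * g z x)"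
    by (rule bounded_kernel_cong)
  then show ?thesis
    using bounded_kernel_compose[OF graphon_bounded_kernel graphon_bounded_kernel] assms by simp
qed

lemma codegree_mem:
  assumes "graphon g" "x \<in> {0..1}" "y \<in> {0..1}" shows "codegree g x y \<in> {0..1}"
proof -
  have *: "0 \<le> g x z * g y z" "g x z * g y z \<le> 1" if "z \<in> {0..1}" for z
    using graphon_mem[OF assms(1,2) that] graphon_mem[OF assms(1,3) that] by (auto simp: mult_le_one)
  have "0 \<le> codegree g x y"
    unfolding codegree_def using * by (intro Bochner_Integration.integral_nonneg) (auto simp: space_unit_interval)
  moreover have "\<bar>codegree g x y\<bar> \<le> 1"
    unfolding codegree_def using * by (intro integral_unit_interval_abs_le) auto
  ultimately show ?thesis by auto
qed

text \<open>With two slots equal to \<open>g\<close> the inner integral is the codegree, so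
  \<open>3 * G\<close> is the gradient of the triangle density at \<open>g\<close>. This links
  triangles to the multiplier equation.\<close>

lemma trilin_codegree:
  assumes "graphon g" shows "trilin f g g = dint (\<lambda>x y. f x y * codegree g x y)"
  unfolding trilin_eq_dint
proof (rule dint_cong)
  fix x y :: real assume xy: "x \<in> {0..1}" "y \<in> {0..1}"
  have "g y z * g z x = g x z * g y z" if "z \<in> {0..1}" for z
    using graphon_sym[OF assms that xy(1)] by simp
  then have "(LINT z|unit_interval. g y z * g z x) = codegree g x y"
    unfolding codegree_def by (intro integral_unit_interval_cong)
  then show "f x y * (LINT z|unit_interval. g y z * g z x) = f x y * codegree g x y"
    by simp
qed

text \<open>The real analysis of the limit of small new classes. Here \<delta> is the mass of the
  class, \<open>c\<close>, \<open>Q\<close> and \<open>h\<close> are the edge, triangle and entropy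
  integrals of its column, \<open>a\<close> and \<open>3 * X\<close> are the first-order changes of
  the two densities of the old part, and \<open>R\<close>, \<open>q\<close> are errors. The two
  equations determine the limits of a / \<delta> and X / \<delta>, which are then inserted into the
  entropy inequality.\<close>

lemma limit_inequality:
  fixes \<delta>\<^sub>0 :: real
  assumes "0 < \<delta>\<^sub>0"
    and ex: "\<And>\<delta>. 0 < \<delta> \<Longrightarrow> \<delta> < \<delta>\<^sub>0 \<Longrightarrow> \<exists>a X R q. \<bar>R\<bar> \<le> K * \<delta>^2 \<and> \<bar>q\<bar> \<le> K * \<delta> \<and>
      (1 - \<delta>)^2 * a = \<epsilon> * (1 - (1 - \<delta>)^2) - 2 * (1 - \<delta>) * \<delta> * c \<and>
      (1 - \<delta>)^3 * (\<tau> + 3 * X + R) + 3 * (1 - \<delta>)^2 * \<delta> * (Q + q) = \<tau> \<and>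
      (1 - \<delta>)^2 * (S + \<alpha> * a + \<beta> * X - K * \<delta>^2) + 2 * (1 - \<delta>) * \<delta> * h \<le> S"
  shows "2 * h - 2 * \<alpha> * c - \<beta> * Q \<le> 2 * S - 2 * \<alpha> * \<epsilon> - \<beta> * \<tau>"
proof -
  let ?F = "at_right (0::real)"
  have "\<exists>a X R q. \<forall>\<delta>. 0 < \<delta> \<longrightarrow> \<delta> < \<delta>\<^sub>0 \<longrightarrow> \<bar>R \<delta>\<bar> \<le> K * \<delta>^2 \<and> \<bar>q \<delta>\<bar> \<le> K * \<delta> \<and>
      (1 - \<delta>)^2 * a \<delta> = \<epsilon> * (1 - (1 - \<delta>)^2) - 2 * (1 - \<delta>) * \<delta> * c \<and>
      (1 - \<delta>)^3 * (\<tau> + 3 * X \<delta> + R \<delta>) + 3 * (1 - \<delta>)^2 * \<delta> * (Q + q \<delta>) = \<tau> \<and>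
      (1 - \<delta>)^2 * (S + \<alpha> * a \<delta> + \<beta> * X \<delta> - K * \<delta>^2) + 2 * (1 - \<delta>) * \<delta> * h \<le> S"
    using ex by metis
  then obtain a X R q where *: "\<And>\<delta>. 0 < \<delta> \<Longrightarrow> \<delta> < \<delta>\<^sub>0 \<Longrightarrow> \<bar>R \<delta>\<bar> \<le> K * \<delta>^2 \<and> \<bar>q \<delta>\<bar> \<le> K * \<delta> \<and>
      (1 - \<delta>)^2 * a \<delta> = \<epsilon> * (1 - (1 - \<delta>)^2) - 2 * (1 - \<delta>) * \<delta> * c \<and>
      (1 - \<delta>)^3 * (\<tau> + 3 * X \<delta> + R \<delta>) + 3 * (1 - \<delta>)^2 * \<delta> * (Q + q \<delta>) = \<tau> \<and>
      (1 - \<delta>)^2 * (S + \<alpha> * a \<delta> + \<beta> * X \<delta> - K * \<delta>^2) + 2 * (1 - \<delta>) * \<delta> * h \<le> S"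
    by blast
  have ev: "\<forall>\<^sub>F \<delta> in ?F. 0 < \<delta> \<and> \<delta> < \<delta>\<^sub>0 \<and> \<delta> < 1"
    using eventually_at_right_real[of 0 "min \<delta>\<^sub>0 1"] assms(1) by (auto elim!: eventually_mono)
  have q: "(q \<longlongrightarrow> 0) ?F"
  proof (rule Lim_null_comparison)
    show "\<forall>\<^sub>F \<delta> in ?F. norm (q \<delta>) \<le> K * \<delta>" using ev by eventually_elim (use * in auto)
    show "((\<lambda>\<delta>. K * \<delta>) \<longlongrightarrow> 0) ?F" by (auto intro!: tendsto_eq_intros)
  qed
  have R: "((\<lambda>\<delta>. R \<delta> / \<delta>) \<longlongrightarrow> 0) ?F"
  proof (rule Lim_null_comparison)
    show "\<forall>\<^sub>F \<delta> in ?F. norm (R \<delta> / \<delta>) \<le> K * \<delta>"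
      using ev by eventually_elim (use * in \<open>auto simp: divide_le_eq power2_eq_square mult.assoc\<close>)
    show "((\<lambda>\<delta>. K * \<delta>) \<longlongrightarrow> 0) ?F" by (auto intro!: tendsto_eq_intros)
  qed
  \<comment> \<open>The edge equation solved for a / \<delta>; the limit is 2 \<epsilon> - 2
    c.\<close>
  have a_eq: "\<forall>\<^sub>F \<delta> in ?F. (\<epsilon> * (2 - \<delta>) - 2 * (1 - \<delta>) * c) / (1 - \<delta>)^2 = a \<delta> / \<delta>"
    using ev
  proof eventually_elim
    case (elim \<delta>)
    then have "(1 - \<delta>)^2 * a \<delta> = \<epsilon> * (1 - (1 - \<delta>)^2) - 2 * (1 - \<delta>) * \<delta> * c" using * by blast
    also have "\<dots> = \<delta> * (\<epsilon> * (2 - \<delta>) - 2 * (1 - \<delta>) * c)"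
      by (simp add: algebra_simps power2_eq_square)
    finally show ?case using elim by (simp add: divide_simps mult.commute)
  qed
  have "((\<lambda>\<delta>. (\<epsilon> * (2 - \<delta>) - 2 * (1 - \<delta>) * c) / (1 - \<delta>)^2) \<longlongrightarrow> 2 * \<epsilon> - 2 * c) ?F"
    by (auto intro!: tendsto_eq_intros)
  then have a: "((\<lambda>\<delta>. a \<delta> / \<delta>) \<longlongrightarrow> 2 * \<epsilon> - 2 * c) ?F"
    by (rule Lim_transform_eventually[OF _ a_eq])
  \<comment> \<open>The triangle equation solved for X / \<delta>; the limit is \<tau> - Q because R
    / \<delta> and q vanish.\<close>
  have X_eq: "\<forall>\<^sub>F \<delta> in ?F. (\<tau> * (3 - 3 * \<delta> + \<delta>^2) - (1 - \<delta>)^3 * (R \<delta> / \<delta>) - 3 * (1 - \<delta>)^2 * (Q + q \<delta>))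
     / (3 * (1 - \<delta>)^3) = X \<delta> / \<delta>"
    using ev
  proof eventually_elim
    case (elim \<delta>)
    then have e: "(1 - \<delta>)^3 * (\<tau> + 3 * X \<delta> + R \<delta>) + 3 * (1 - \<delta>)^2 * \<delta> * (Q + q \<delta>) = \<tau>" using * by blast
    have "3 * (1 - \<delta>)^3 * X \<delta> = \<tau> - (1 - \<delta>)^3 * \<tau> - (1 - \<delta>)^3 * R \<delta> - 3 * (1 - \<delta>)^2 * \<delta> * (Q + q \<delta>)"
      using e by (simp add: distrib_left)
    also have "\<tau> - (1 - \<delta>)^3 * \<tau> = \<delta> * (\<tau> * (3 - 3 * \<delta> + \<delta>^2))"
      by (simp add: algebra_simps power2_eq_square power3_eq_cube)
    finally have "3 * (1 - \<delta>)^3 * X \<delta> = \<delta> * (\<tau> * (3 - 3 * \<delta> + \<delta>^2) - (1 - \<delta>)^3 * (R \<delta> / \<delta>) - 3 * (1 - \<delta>)^2 * (Q + q \<delta>))"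
      using elim by (simp add: right_diff_distrib)
    moreover have "3 * (1 - \<delta>)^3 > 0" using elim by simp
    ultimately show ?case using elim by (simp add: nonzero_divide_eq_eq nonzero_eq_divide_eq ac_simps)
  qed
  have "((\<lambda>\<delta>. (\<tau> * (3 - 3 * \<delta> + \<delta>^2) - (1 - \<delta>)^3 * (R \<delta> / \<delta>) - 3 * (1 - \<delta>)^2 * (Q + q \<delta>))
     / (3 * (1 - \<delta>)^3)) \<longlongrightarrow> \<tau> - Q) ?F"
    by (rule tendsto_eq_intros R q refl | simp)+
  then have X: "((\<lambda>\<delta>. X \<delta> / \<delta>) \<longlongrightarrow> \<tau> - Q) ?F"
    by (rule Lim_transform_eventually[OF _ X_eq])
  \<comment> \<open>The entropy inequality after subtracting \<open>(1 - \<delta>)^2 * S\<close> and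
    dividing by \<delta>.\<close>
  have le: "\<forall>\<^sub>F \<delta> in ?F. (1 - \<delta>)^2 * (\<alpha> * (a \<delta> / \<delta>) + \<beta> * (X \<delta> / \<delta>) - K * \<delta>) + 2 * (1 - \<delta>) * h
      \<le> S * (2 - \<delta>)"
    using ev
  proof eventually_elim
    case (elim \<delta>)
    then have e: "(1 - \<delta>)^2 * (S + \<alpha> * a \<delta> + \<beta> * X \<delta> - K * \<delta>^2) + 2 * (1 - \<delta>) * \<delta> * h \<le> S" using * by blast
    have "\<delta> * ((1 - \<delta>)^2 * (\<alpha> * (a \<delta> / \<delta>) + \<beta> * (X \<delta> / \<delta>) - K * \<delta>) + 2 * (1 - \<delta>) * h)
      = (1 - \<delta>)^2 * (S + \<alpha> * a \<delta> + \<beta> * X \<delta> - K * \<delta>^2) + 2 * (1 - \<delta>) * \<delta> * h - (1 - \<delta>)^2 * S"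
      using elim by (simp add: field_simps power2_eq_square)
    also have "\<dots> \<le> S - (1 - \<delta>)^2 * S" using e by simp
    also have "\<dots> = \<delta> * (S * (2 - \<delta>))" by (simp add: algebra_simps power2_eq_square)
    finally show ?case using elim by simp
  qed
  have "(1 - 0)^2 * (\<alpha> * (2 * \<epsilon> - 2 * c) + \<beta> * (\<tau> - Q) - K * 0) + 2 * (1 - 0) * h \<le> S * (2 - 0)"
    by (rule tendsto_le[OF _ _ _ le]) (intro tendsto_intros a X trivial_limit_at_right_real)+
  then show ?thesis by (simp add: algebra_simps)
qed

section \<open>Maximizers bounded away from 0 and 1\<close>

text \<open>The distance \<eta> from 0 and 1 is required everywhere, so that small uniform
  perturbations stay graphons. A general maximizer is brought to this form by changing it on a null
  set.\<close>

locale interior_maximizer =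
  fixes g :: "real \<Rightarrow> real \<Rightarrow> real" and \<alpha> \<beta> \<eta> :: real
  assumes maximizer: "entropy_maximizer g"
    and eta: "0 < \<eta>" "\<And>x y. x \<in> {0..1} \<Longrightarrow> y \<in> {0..1} \<Longrightarrow> g x y \<in> {\<eta>..1-\<eta>}"
    and lagrange: "AE (x, y) in unit_interval \<Otimes>\<^sub>M unit_interval.
          ln ((1 - g x y) / g x y) = \<alpha> + \<beta> * codegree g x y"
    and not_const: "\<not> (\<exists>c. AE (x, y) in unit_interval \<Otimes>\<^sub>M unit_interval. codegree g x y = c)"
begin

abbreviation "\<epsilon> \<equiv> edge_density g"
abbreviation "\<tau> \<equiv> triangle_density g"
abbreviation "G \<equiv> codegree g"
text \<open>Centering \<open>G\<close> makes \<open>\<psi>\<close> invisible to the edge density: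
  \<open>a\<close> alone moves the edges, while \<open>b\<close> moves the triangles at rate
  \<open>3 * V\<close> to first order. \<open>V\<close> is the variance of \<open>G\<close>.\<close>

definition "m = dint G"
definition "\<psi> = (\<lambda>x y. G x y - m)"
definition "V = dint (\<lambda>x y. \<psi> x y * \<psi> x y)"

definition perturb :: "real \<Rightarrow> real \<Rightarrow> real \<Rightarrow> real \<Rightarrow> real" where
  "perturb a b x y = a + b * \<psi> x y"

lemma graphon_g: "graphon g" using maximizer by (simp add: entropy_maximizer_def)

lemma eta_le: "\<eta> \<le> 1 / 2" using eta(2)[of 0 0] by simp

lemma bounded_G [simp]: "bounded_kernel G"
  by (rule bounded_kernel_codegree[OF graphon_g])

lemma bounded_g [simp]: "bounded_kernel g"
  by (rule graphon_bounded_kernel[OF graphon_g])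

lemma m_mem: "m \<in> {0..1}"
proof -
  have "dint (\<lambda>_ _. 0) \<le> dint G"
    using codegree_mem[OF graphon_g]
    by (intro dint_mono_AE) (auto simp: space_pair_measure space_unit_interval intro!: AE_I2)
  moreover have "dint G \<le> dint (\<lambda>_ _. 1)"
    using codegree_mem[OF graphon_g]
    by (intro dint_mono_AE) (auto simp: space_pair_measure space_unit_interval intro!: AE_I2)
  ultimately show ?thesis unfolding m_def dint_const by simp
qed

lemma psi_abs_le: "x \<in> {0..1} \<Longrightarrow> y \<in> {0..1} \<Longrightarrow> \<bar>\<psi> x y\<bar> \<le> 1"
  using codegree_mem[OF graphon_g, of x y] m_mem by (auto simp: \<psi>_def)

lemma bounded_psi [simp]: "bounded_kernel \<psi>"
  using bounded_kernel_add[OF bounded_G bounded_kernel_const[of "- m"]] by (simp add: \<psi>_def)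

lemma dint_psi: "dint \<psi> = 0"
  using dint_add[OF bounded_G bounded_kernel_const[of "- m"]] dint_const[of "- m"]
  by (simp add: \<psi>_def m_def)

lemma bounded_perturb [simp]: "bounded_kernel (perturb a b)"
  unfolding perturb_def[abs_def]
  by (intro bounded_kernel_add bounded_kernel_mult bounded_kernel_const bounded_psi)

lemma perturb_abs_le:
  assumes "x \<in> {0..1}" "y \<in> {0..1}" shows "\<bar>perturb a b x y\<bar> \<le> \<bar>a\<bar> + \<bar>b\<bar>"
proof -
  have "\<bar>b\<bar> * \<bar>\<psi> x y\<bar> \<le> \<bar>b\<bar> * 1"
    using psi_abs_le[OF assms] by (intro mult_left_mono) auto
  then show ?thesis unfolding perturb_def using abs_triangle_ineq[of a "b * \<psi> x y"]
    by (simp add: abs_mult)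
qed

lemma dint_perturb: "dint (perturb a b) = a"
  using dint_add[OF bounded_kernel_const[of a] bounded_kernel_mult[OF bounded_kernel_const[of b] bounded_psi]]
    dint_const[of a] dint_psi by (simp add: perturb_def[abs_def])

lemma dint_perturb_G: "dint (\<lambda>x y. perturb a b x y * G x y) = a * m + b * V"
proof -
  have [simp]: "bounded_kernel (\<lambda>x y. a * G x y)" "bounded_kernel (\<lambda>x y. b * (\<psi> x y * \<psi> x y))"
    "bounded_kernel (\<lambda>x y. (b * m) * \<psi> x y)"
    by (intro bounded_kernel_mult bounded_kernel_const bounded_psi bounded_G)+
  have "dint (\<lambda>x y. perturb a b x y * G x y) =
      dint (\<lambda>x y. a * G x y + (b * (\<psi> x y * \<psi> x y) + (b * m) * \<psi> x y))"
    by (simp add: perturb_def \<psi>_def algebra_simps)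
  also have "\<dots> = dint (\<lambda>x y. a * G x y) + (dint (\<lambda>x y. b * (\<psi> x y * \<psi> x y)) + dint (\<lambda>x y. (b * m) * \<psi> x y))"
    by (subst dint_add, simp, intro bounded_kernel_add, simp, simp, subst dint_add) simp_all
  finally show ?thesis by (simp add: dint_psi V_def m_def)
qed

text \<open>Zero variance would make \<open>G\<close> constant almost everywhere. This is where
  nonsingularity enters.\<close>

lemma V_pos: "0 < V"
proof -
  have b: "bounded_kernel (\<lambda>x y. \<psi> x y * \<psi> x y)" by (intro bounded_kernel_mult bounded_psi)
  let ?P = "unit_interval \<Otimes>\<^sub>M unit_interval"
  have "0 \<le> V" unfolding V_def dint_eq[OF b]
    by (intro Bochner_Integration.integral_nonneg) (simp add: case_prod_unfold)
  moreover have "V \<noteq> 0"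
  proof
    assume "V = 0"
    then have "(LINT p|?P. case_prod (\<lambda>x y. \<psi> x y * \<psi> x y) p) = 0"
      unfolding V_def dint_eq[OF b] .
    then have "AE p in ?P. case_prod (\<lambda>x y. \<psi> x y * \<psi> x y) p = 0"
      by (subst (asm) integral_nonneg_eq_0_iff_AE[OF integrable_bounded_kernel[OF b]])
         (simp_all add: case_prod_unfold)
    then have "AE (x, y) in ?P. G x y = m"
      by eventually_elim (auto simp: \<psi>_def)
    then show False using not_const by blast
  qed
  ultimately show ?thesis by simp
qed

section \<open>Effect of the perturbation on edges, triangles and entropy\<close>

lemma graphon_perturb:
  assumes "\<bar>a\<bar> + \<bar>b\<bar> \<le> \<eta>"
  shows "graphon (\<lambda>x y. g x y + perturb a b x y)"
proof -
  have "g x y + perturb a b x y \<in> {0..1}" if "x \<in> {0..1}" "y \<in> {0..1}" for x y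
    using perturb_abs_le[OF that, of a b] eta(2)[OF that] assms by auto
  moreover have "G x y = G y x" for x y by (simp add: codegree_def mult.commute)
  then have "g x y + perturb a b x y = g y x + perturb a b y x" if "x \<in> {0..1}" "y \<in> {0..1}" for x y
    using graphon_sym[OF graphon_g that] by (simp add: perturb_def \<psi>_def)
  ultimately show ?thesis
    using bounded_kernel_measurable[OF bounded_kernel_add[OF bounded_g bounded_perturb[of a b]]]
    unfolding graphon_def by (auto simp: case_prod_unfold)
qed

text \<open>The terms with two or three perturbation factors are at most
  \<open>3 * M^2 + M^3\<close> for M = \<bar>a\<bar> + \<bar>b\<bar>, and \<open>M \<le> 1\<close>
  turns this into \<open>4 * M^2\<close>.\<close>

lemma triangle_density_perturb:
  assumes "\<bar>a\<bar> + \<bar>b\<bar> \<le> 1"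
  shows "\<bar>triangle_density (\<lambda>x y. g x y + perturb a b x y) - (\<tau> + 3 * (a * m + b * V))\<bar>
    \<le> 4 * (\<bar>a\<bar> + \<bar>b\<bar>)^2"
proof -
  let ?f = "perturb a b" and ?M = "\<bar>a\<bar> + \<bar>b\<bar>"
  have g1: "\<bar>g x y\<bar> \<le> 1" if "x \<in> {0..1}" "y \<in> {0..1}" for x y
    using graphon_mem[OF graphon_g that] by auto
  have "triangle_density (\<lambda>x y. g x y + perturb a b x y) - (\<tau> + 3 * (a * m + b * V))
      = 3 * trilin ?f ?f g + trilin ?f ?f ?f"
    using triangle_density_add_cmult[OF bounded_g bounded_perturb, of 1 a b]
    by (simp add: trilin_codegree[OF graphon_g] dint_perturb_G)
  moreover have "\<bar>trilin ?f ?f g\<bar> \<le> ?M * ?M * 1"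
    by (rule trilin_abs_le) (rule perturb_abs_le g1, assumption, assumption)+
  moreover have "\<bar>trilin ?f ?f ?f\<bar> \<le> ?M * ?M * ?M"
    by (rule trilin_abs_le) (rule perturb_abs_le, assumption, assumption)+
  moreover have "?M * ?M * ?M \<le> ?M * ?M * 1"
    using assms by (intro mult_left_mono) auto
  ultimately show ?thesis unfolding power2_eq_square by linarith
qed

lemma edge_density_perturb: "edge_density (\<lambda>x y. g x y + perturb a b x y) = \<epsilon> + a"
  unfolding edge_density_def by (subst dint_add) (simp_all add: dint_perturb)

text \<open>The tangent bound is integrated after its slope H'(g) has been replaced by \<alpha> +
  \<beta> G. The entropy thus changes to first order by \<alpha> times the change in edges plus
  \<beta> / 3 times the change in triangles.\<close>

lemma graphon_entropy_perturb:
  assumes "\<bar>a\<bar> + \<bar>b\<bar> \<le> \<eta> / 2"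
  shows "graphon_entropy g + \<alpha> * a + \<beta> * (a * m + b * V) - 2 / \<eta> * (\<bar>a\<bar> + \<bar>b\<bar>)^2
    \<le> graphon_entropy (\<lambda>x y. g x y + perturb a b x y)"
proof -
  let ?f = "perturb a b" and ?K = "2 / \<eta> * (\<bar>a\<bar> + \<bar>b\<bar>)^2"
  define u where "u = (\<lambda>x y. H (g x y) + (\<alpha> * ?f x y + (\<beta> * (?f x y * G x y) + (- ?K))))"
  have b[simp]: "bounded_kernel (\<lambda>x y. H (g x y))" "bounded_kernel (\<lambda>x y. \<alpha> * ?f x y)"
    "bounded_kernel (\<lambda>x y. \<beta> * (?f x y * G x y))"
    by (intro bounded_kernel_H graphon_g bounded_kernel_mult bounded_kernel_const bounded_perturb bounded_G)+
  have b2: "bounded_kernel (\<lambda>x y. \<beta> * (?f x y * G x y) + (- ?K))"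
    by (intro bounded_kernel_add b bounded_kernel_const)
  have b3: "bounded_kernel (\<lambda>x y. \<alpha> * ?f x y + (\<beta> * (?f x y * G x y) + (- ?K)))"
    by (intro bounded_kernel_add b b2)
  have bu: "bounded_kernel u" unfolding u_def by (intro bounded_kernel_add b b3)
  have "dint u = graphon_entropy g + \<alpha> * a + \<beta> * (a * m + b * V) - ?K"
    unfolding u_def
    by (subst dint_add[OF b(1) b3], subst dint_add[OF b(2) b2],
        subst dint_add[OF b(3) bounded_kernel_const], subst dint_const)
       (simp add: graphon_entropy_def dint_perturb dint_perturb_G)
  moreover have "dint u \<le> dint (\<lambda>x y. H (g x y + ?f x y))"
  proof (rule dint_mono_AE[OF bu])
    show "bounded_kernel (\<lambda>x y. H (g x y + ?f x y))"
      using assms eta(1) by (intro bounded_kernel_H graphon_perturb) auto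
    show "AE (x, y) in unit_interval \<Otimes>\<^sub>M unit_interval. u x y \<le> H (g x y + ?f x y)"
      using lagrange AE_space
    proof eventually_elim
      case (elim p)
      obtain x y where p: "p = (x, y)" by force
      have xy: "x \<in> {0..1}" "y \<in> {0..1}"
        using elim(2) by (auto simp: p space_pair_measure space_unit_interval)
      have f: "\<bar>?f x y\<bar> \<le> \<bar>a\<bar> + \<bar>b\<bar>" by (rule perturb_abs_le[OF xy])
      have e: "\<eta> \<le> g x y" "g x y \<le> 1 - \<eta>" using eta(2)[OF xy] by auto
      have "H (g x y) + ln ((1 - g x y) / g x y) * ?f x y - 2 / \<eta> * (?f x y)^2 \<le> H (g x y + ?f x y)"
        using f e assms eta(1) by (intro H_ge_tangent) auto
      moreover have "2 / \<eta> * (?f x y)^2 \<le> ?K"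
        using f eta(1) by (intro mult_left_mono) (auto simp: abs_le_square_iff[symmetric])
      ultimately show ?case
        using elim(1) by (simp add: p u_def algebra_simps)
    qed
  qed
  ultimately show ?thesis by (simp add: graphon_entropy_def)
qed

text \<open>The competitor is the blow-up of the perturbed kernel by \<open>C\<close>. The two
  equations say that it has the densities of \<open>g\<close>, so maximality applies.\<close>

lemma graphon_entropy_blowup_le:
  assumes s: "0 < s" "s < 1" and C: "unit_function C"
    and ab: "\<bar>a\<bar> + \<bar>b\<bar> \<le> \<eta> / 2"
    and edge: "s^2 * (\<epsilon> + a) + 2 * s * (1 - s) * (LINT y|unit_interval. C y) = \<epsilon>"
    and triangle: "s^3 * triangle_density (\<lambda>x y. g x y + perturb a b x y)
      + 3 * s^2 * (1 - s) * column_form (\<lambda>x y. g x y + perturb a b x y) C = \<tau>"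
  shows "s^2 * graphon_entropy (\<lambda>x y. g x y + perturb a b x y)
    + 2 * s * (1 - s) * (LINT y|unit_interval. H (C y)) \<le> graphon_entropy g"
proof -
  let ?k = "\<lambda>x y. g x y + perturb a b x y"
  have k: "graphon ?k" using ab eta(1) by (intro graphon_perturb) auto
  note bk = graphon_bounded_kernel[OF k] and bC = unit_function_bounded_function[OF C]
  have 1: "edge_density (blowup s ?k C) = \<epsilon>"
    using dint_blowup[OF s bk bC] edge edge_density_perturb[of a b] by (simp add: edge_density_def)
  have 2: "triangle_density (blowup s ?k C) = \<tau>"
    using triangle_density_blowup[OF s bk bC graphon_sym[OF k]] triangle by simp
  have 3: "graphon_entropy (blowup s ?k C) = s^2 * graphon_entropy ?k
    + 2 * s * (1 - s) * (LINT y|unit_interval. H (C y))"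
    using dint_blowup[OF s bounded_kernel_H[OF k] bounded_function_H[OF C]]
    by (simp add: graphon_entropy_def H_blowup)
  show ?thesis
    using maximizer graphon_blowup[OF s k C] 1 2 3 by (auto simp: entropy_maximizer_def)
qed

lemma edge_density_mem: "\<epsilon> \<in> {0..1}" "\<tau> \<in> {0..1}"
proof -
  have *: "0 \<le> g x y" "g x y \<le> 1" if "x \<in> {0..1}" "y \<in> {0..1}" for x y
    using graphon_mem[OF graphon_g that] by auto
  have "0 \<le> \<epsilon>" "0 \<le> \<tau>" unfolding edge_density_def triangle_density_def
    using * by (auto intro!: Bochner_Integration.integral_nonneg mult_nonneg_nonneg simp: space_unit_interval)
  moreover have "\<bar>\<epsilon>\<bar> \<le> 1" unfolding edge_density_def
    using * by (intro dint_abs_le) auto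
  moreover have "\<bar>\<tau>\<bar> \<le> 1 * 1 * 1" unfolding triangle_density_eq_trilin
    using * by (intro trilin_abs_le) auto
  ultimately show "\<epsilon> \<in> {0..1}" "\<tau> \<in> {0..1}" by auto
qed

text \<open>\<open>L\<close> is chosen so that at \<open>b = \<plusminus> L \<delta>\<close> the leading term \<open>3 s\<^sup>3 b V\<close> of the change in triangle
  density, of size at least \<open>60 \<delta>\<close>, beats all other terms, which add up to at most \<open>60 \<delta>\<close>.\<close>

lemma exists_perturbation:
  assumes C: "unit_function C"
    and L: "L = 160 / V"
    and d: "0 < \<delta>" "\<delta> \<le> 1 / 2" "(8 + L) * \<delta> \<le> \<eta> / 2" "4 * (8 + L)^2 * \<delta> \<le> 30"
    and s: "s = 1 - \<delta>"
  obtains a b where "\<bar>a\<bar> + \<bar>b\<bar> \<le> (8 + L) * \<delta>"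
    "s^2 * a = \<epsilon> * (1 - s^2) - 2 * s * \<delta> * (LINT y|unit_interval. C y)"
    "s^3 * triangle_density (\<lambda>x y. g x y + perturb a b x y)
      + 3 * s^2 * \<delta> * column_form (\<lambda>x y. g x y + perturb a b x y) C = \<tau>"
proof -
  define c where "c = (LINT y|unit_interval. C y)"
  have c: "c \<in> {0..1}"
  proof -
    have "\<bar>c\<bar> \<le> 1" unfolding c_def
      using C by (intro integral_unit_interval_abs_le) (auto simp: unit_function_def)
    moreover have "0 \<le> c" unfolding c_def
      using C by (intro Bochner_Integration.integral_nonneg) (auto simp: unit_function_def space_unit_interval)
    ultimately show ?thesis by simp
  qed
  have s01: "1 / 2 \<le> s" "s < 1" using d s by auto
  have s2: "1 / 4 \<le> s^2" "s^2 \<le> 1"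
    using power_mono[of "1/2" s 2] power_le_one[of s 2] s01 by (auto simp: power2_eq_square)
  have s3: "1 / 8 \<le> s^3" "s^3 \<le> 1"
    using power_mono[of "1/2" s 3] power_le_one[of s 3] s01 by (auto simp: power3_eq_cube)
  have L0: "0 < L" using L V_pos by simp
  \<comment> \<open>The solution of the edge equation, which is affine in \<open>a\<close> and does
    not involve \<open>b\<close>.\<close>
  define a where "a = (\<epsilon> * (1 - s^2) - 2 * s * \<delta> * c) / s^2"
  have a_eq: "s^2 * a = \<epsilon> * (1 - s^2) - 2 * s * \<delta> * c"
    unfolding a_def using s01 by simp
  have "0 \<le> 2 * s * \<delta> * c" "0 \<le> \<epsilon> * (1 - s^2)"
    using s01 s2 d c edge_density_mem by auto
  moreover have "2 * s * \<delta> * c \<le> 2 * \<delta>"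
    using mult_mono[of s 1 c 1] s01 c d by (simp add: mult.commute mult.left_commute)
  moreover have "\<epsilon> * (1 - s^2) \<le> 2 * \<delta>"
  proof -
    have "\<epsilon> * (1 - s^2) \<le> 1 * (1 - s^2)"
      using edge_density_mem s2 by (intro mult_right_mono) auto
    also have "\<dots> \<le> 2 * \<delta>" unfolding s by (simp add: power2_eq_square algebra_simps)
    finally show ?thesis .
  qed
  moreover have "\<bar>A - B\<bar> \<le> 2 * \<delta>" if "0 \<le> B" "0 \<le> A" "B \<le> 2 * \<delta>" "A \<le> 2 * \<delta>" for A B :: real
    using that by linarith
  ultimately have "\<bar>s^2 * a\<bar> \<le> 2 * \<delta>" unfolding a_eq by blast
  moreover have "1 / 4 * \<bar>a\<bar> \<le> s^2 * \<bar>a\<bar>" using s2 by (intro mult_right_mono) auto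
  \<comment> \<open>The constant 8 is 2 divided by the lower bound 1/4 for
    \<open>s^2\<close>.\<close>
  ultimately have a: "\<bar>a\<bar> \<le> 8 * \<delta>" by (simp add: abs_mult)
  define k where "k = (\<lambda>b x y. g x y + perturb a b x y)"
  \<comment> \<open>The triangle density of the blow-up as a function of the remaining parameter
    \<open>b\<close>.\<close>
  define \<Phi> where "\<Phi> = (\<lambda>b. s^3 * triangle_density (k b) + 3 * s^2 * \<delta> * column_form (k b) C)"
  have ab: "\<bar>a\<bar> + \<bar>b\<bar> \<le> (8 + L) * \<delta>" if "\<bar>b\<bar> \<le> L * \<delta>" for b
    using a that by (simp add: distrib_right)
  have k_eq: "k b = (\<lambda>x y. (g x y + a) + b * \<psi> x y)" for b
    by (simp add: k_def perturb_def fun_eq_iff)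
  have bk: "bounded_kernel (\<lambda>x y. g x y + a)"
    by (intro bounded_kernel_add bounded_kernel_const bounded_g)
  have cont: "continuous_on {- (L * \<delta>)..L * \<delta>} \<Phi>"
    unfolding \<Phi>_def k_eq triangle_density_add_cmult[OF bk bounded_psi]
      column_form_add_cmult[OF bk bounded_psi unit_function_bounded_function[OF C]]
    by (intro continuous_intros)
  \<comment> \<open>The budget is 60 = 3 + 24 + 30 + 3: loss of old triangles, effect of
    \<open>a\<close>, quadratic remainder, triangles at the new class.\<close>
  have est: "\<bar>\<Phi> b - \<tau> - 3 * s^3 * (b * V)\<bar> \<le> 60 * \<delta>" if b: "\<bar>b\<bar> \<le> L * \<delta>" for b
  proof -
    have abn: "\<bar>a\<bar> + \<bar>b\<bar> \<le> (8 + L) * \<delta>" by (rule ab[OF b])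
    have m1: "\<bar>a\<bar> + \<bar>b\<bar> \<le> \<eta> / 2" using abn d by linarith
    have gk: "graphon (k b)" unfolding k_def using m1 eta(1) by (intro graphon_perturb) auto
    define R where "R = triangle_density (k b) - (\<tau> + 3 * (a * m + b * V))"
    have "\<bar>R\<bar> \<le> 4 * (\<bar>a\<bar> + \<bar>b\<bar>)^2"
      unfolding R_def k_def using m1 eta_le by (intro triangle_density_perturb) auto
    also have "\<dots> \<le> 4 * ((8 + L) * \<delta>)^2"
      using abn by (intro mult_left_mono power_mono) auto
    also have "\<dots> = 4 * (8 + L)^2 * \<delta> * \<delta>" by (simp add: power2_eq_square)
    also have "\<dots> \<le> 30 * \<delta>" using d by (intro mult_right_mono) auto
    finally have R: "\<bar>R\<bar> \<le> 30 * \<delta>" .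
    have "\<bar>s^3 * R\<bar> \<le> 1 * (30 * \<delta>)" unfolding abs_mult using R s3 by (intro mult_mono) auto
    moreover have "\<bar>column_form (k b) C\<bar> \<le> 1"
      using graphon_mem[OF gk] by (intro column_form_abs_le[OF C]) auto
    then have "\<bar>3 * s^2 * \<delta> * column_form (k b) C\<bar> \<le> 3 * \<delta> * 1"
      unfolding abs_mult using s2 d by (intro mult_mono) (auto intro!: mult_le_cancel_right1[THEN iffD2])
    moreover have "\<bar>3 * s^3 * (a * m)\<bar> \<le> 3 * 1 * (8 * \<delta> * 1)"
      unfolding abs_mult using s3 a m_mem d by (intro mult_mono) auto
    moreover have "0 \<le> (1 - s^3) * \<tau>"
      using s3 edge_density_mem by (intro mult_nonneg_nonneg) simp_all
    moreover have "(1 - s^3) * \<tau> \<le> 3 * \<delta>"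
    proof -
      have "(1 - s^3) * \<tau> \<le> (1 - s^3) * 1"
        using s3 edge_density_mem by (intro mult_left_mono) simp_all
      moreover
      have "3 * \<delta> - (1 - s^3) = \<delta>^2 * (3 - \<delta>)"
        unfolding s by (simp add: power2_eq_square power3_eq_cube algebra_simps)
      moreover have "\<dots> \<ge> 0" using d by simp
      ultimately show ?thesis by simp
    qed
    moreover have "\<Phi> b - \<tau> - 3 * s^3 * (b * V) =
       - ((1 - s^3) * \<tau>) + 3 * s^3 * (a * m) + s^3 * R + 3 * s^2 * \<delta> * column_form (k b) C"
      by (simp add: \<Phi>_def R_def algebra_simps)
    moreover have "\<bar>- t + u + v + w\<bar> \<le> 60 * \<delta>"
      if "\<bar>v\<bar> \<le> 1 * (30 * \<delta>)" "\<bar>w\<bar> \<le> 3 * \<delta> * 1" "\<bar>u\<bar> \<le> 3 * 1 * (8 * \<delta> * 1)"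
        "0 \<le> t" "t \<le> 3 * \<delta>" for t u v w :: real
      using that unfolding abs_le_iff by simp
    ultimately show ?thesis by metis
  qed
  have big: "60 * \<delta> \<le> 3 * s^3 * (L * \<delta> * V)"
  proof -
    \<comment> \<open>With \<open>s^3 \<ge> 1 / 8\<close>, the factor 160 gives 3 * 160 / 8 = 60,
      exactly the budget.\<close>
    have "L * \<delta> * V = 160 * \<delta>" using L V_pos by simp
    then show ?thesis using s3 d by simp
  qed
  have "\<exists>b\<ge>- (L * \<delta>). b \<le> L * \<delta> \<and> \<Phi> b = \<tau>"
  proof (rule IVT'[OF _ _ _ cont])
    have "\<bar>\<Phi> (- (L * \<delta>)) - \<tau> + 3 * s^3 * (L * \<delta> * V)\<bar> \<le> 60 * \<delta>"
      using est[of "- (L * \<delta>)"] L0 d by simp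
    then show "\<Phi> (- (L * \<delta>)) \<le> \<tau>" using big by linarith
    have "\<bar>\<Phi> (L * \<delta>) - \<tau> - 3 * s^3 * (L * \<delta> * V)\<bar> \<le> 60 * \<delta>"
      using est[of "L * \<delta>"] L0 d by simp
    then show "\<tau> \<le> \<Phi> (L * \<delta>)" using big by linarith
    show "- (L * \<delta>) \<le> L * \<delta>" using L0 d by simp
  qed
  then obtain b where "- (L * \<delta>) \<le> b" "b \<le> L * \<delta>" and b2: "\<Phi> b = \<tau>" by blast
  then have b1: "\<bar>b\<bar> \<le> L * \<delta>" by simp
  show ?thesis
    using that[OF ab[OF b1]] a_eq b2 unfolding \<Phi>_def k_def c_def by blast
qed

lemma worth_le:
  assumes C: "unit_function C"
  shows "worth g \<alpha> \<beta> C \<le> 2 * graphon_entropy g - 2 * \<alpha> * \<epsilon> - \<beta> * \<tau>"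
proof -
  define L where "L = 160 / V"
  define N where "N = 8 + L"
  \<comment> \<open>\<open>K\<close> dominates the three error constants: \<open>N\<close> for the
    column form, \<open>4 * N^2\<close> for triangles, \<open>2 / \<eta> * N^2\<close> for
    entropy.\<close>
  define K where "K = N + 4 * N^2 + 2 / \<eta> * N^2"
  have N: "0 < N" using V_pos by (simp add: N_def L_def add_pos_pos)
  \<comment> \<open>The three bounds are the smallness conditions of
    \<open>exists_perturbation\<close>.\<close>
  define \<delta>\<^sub>0 where "\<delta>\<^sub>0 = Min {1 / 2, \<eta> / (2 * N), 30 / (4 * N^2)}"
  have d0: "0 < \<delta>\<^sub>0" unfolding \<delta>\<^sub>0_def using N eta(1) by simp
  have K: "N \<le> K" "4 * N^2 \<le> K" "2 / \<eta> * N^2 \<le> K"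
    unfolding K_def using N eta(1) by auto
  have "2 * (LINT y|unit_interval. H (C y)) - 2 * \<alpha> * (LINT y|unit_interval. C y) - \<beta> * column_form g C
     \<le> 2 * graphon_entropy g - 2 * \<alpha> * \<epsilon> - \<beta> * \<tau>"
  proof (rule limit_inequality[OF d0])
    fix \<delta> :: real assume d: "0 < \<delta>" "\<delta> < \<delta>\<^sub>0"
    then have d12: "\<delta> \<le> 1 / 2" and d3: "N * \<delta> \<le> \<eta> / 2" and d4: "4 * N^2 * \<delta> \<le> 30"
      using N by (auto simp: \<delta>\<^sub>0_def field_simps)
    define s where "s = 1 - \<delta>"
    have s: "0 < s" "s < 1" "1 - s = \<delta>" using d d12 by (auto simp: s_def)
    obtain a b where ab: "\<bar>a\<bar> + \<bar>b\<bar> \<le> N * \<delta>"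
      and edge: "s^2 * a = \<epsilon> * (1 - s^2) - 2 * s * \<delta> * (LINT y|unit_interval. C y)"
      and triangle: "s^3 * triangle_density (\<lambda>x y. g x y + perturb a b x y)
        + 3 * s^2 * \<delta> * column_form (\<lambda>x y. g x y + perturb a b x y) C = \<tau>"
      using exists_perturbation[OF C L_def d(1) d12 d3[unfolded N_def] d4[unfolded N_def] s_def]
      unfolding N_def by blast
    define X where "X = a * m + b * V"
    define R where "R = triangle_density (\<lambda>x y. g x y + perturb a b x y) - (\<tau> + 3 * X)"
    define q where "q = column_form (perturb a b) C"
    have m1: "\<bar>a\<bar> + \<bar>b\<bar> \<le> \<eta> / 2" using ab d3 by linarith
    have sq: "(\<bar>a\<bar> + \<bar>b\<bar>)^2 \<le> N^2 * \<delta>^2"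
      using power_mono[OF ab, of 2] by (simp add: power_mult_distrib)
    have "\<bar>R\<bar> \<le> 4 * (\<bar>a\<bar> + \<bar>b\<bar>)^2"
      unfolding R_def X_def using m1 eta_le by (intro triangle_density_perturb) auto
    also have "\<dots> \<le> (4 * N^2) * \<delta>^2" using sq by simp
    also have "\<dots> \<le> K * \<delta>^2" using K by (intro mult_right_mono) auto
    finally have R: "\<bar>R\<bar> \<le> K * \<delta>^2" .
    have "\<bar>q\<bar> \<le> N * \<delta>"
      unfolding q_def using ab by (intro column_form_abs_le[OF C]) (rule order_trans[OF perturb_abs_le])
    also have "\<dots> \<le> K * \<delta>" using K d by (intro mult_right_mono) auto
    finally have q: "\<bar>q\<bar> \<le> K * \<delta>" .
    have cf: "column_form (\<lambda>x y. g x y + perturb a b x y) C = column_form g C + q"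
      using column_form_add_cmult[OF bounded_g bounded_perturb unit_function_bounded_function[OF C], of 1 a b]
      by (simp add: q_def)
    have tri: "s^3 * (\<tau> + 3 * X + R) + 3 * s^2 * \<delta> * (column_form g C + q) = \<tau>"
      using triangle unfolding cf R_def by simp
    have "s^2 * graphon_entropy (\<lambda>x y. g x y + perturb a b x y)
        + 2 * s * \<delta> * (LINT y|unit_interval. H (C y)) \<le> graphon_entropy g"
      using graphon_entropy_blowup_le[OF s(1,2) C m1] edge triangle unfolding s(3)
      by (simp add: algebra_simps)
    moreover have "2 / \<eta> * (\<bar>a\<bar> + \<bar>b\<bar>)^2 \<le> K * \<delta>^2"
    proof -
      have "2 / \<eta> * (\<bar>a\<bar> + \<bar>b\<bar>)^2 \<le> 2 / \<eta> * (N^2 * \<delta>^2)"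
        using sq eta(1) by (intro mult_left_mono) auto
      also have "\<dots> = (2 / \<eta> * N^2) * \<delta>^2" by simp
      also have "\<dots> \<le> K * \<delta>^2" using K by (intro mult_right_mono) auto
      finally show ?thesis .
    qed
    then have "graphon_entropy g + \<alpha> * a + \<beta> * X - K * \<delta>^2
        \<le> graphon_entropy (\<lambda>x y. g x y + perturb a b x y)"
      using graphon_entropy_perturb[OF m1] unfolding X_def by linarith
    then have "s^2 * (graphon_entropy g + \<alpha> * a + \<beta> * X - K * \<delta>^2)
       \<le> s^2 * graphon_entropy (\<lambda>x y. g x y + perturb a b x y)"
      by (intro mult_left_mono) auto
    ultimately have "s^2 * (graphon_entropy g + \<alpha> * a + \<beta> * X - K * \<delta>^2)
       + 2 * s * \<delta> * (LINT y|unit_interval. H (C y)) \<le> graphon_entropy g" by linarith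
    with R q tri edge
    show "\<exists>a X R q. \<bar>R\<bar> \<le> K * \<delta>^2 \<and> \<bar>q\<bar> \<le> K * \<delta> \<and>
      (1 - \<delta>)^2 * a = \<epsilon> * (1 - (1 - \<delta>)^2) - 2 * (1 - \<delta>) * \<delta> * (LINT y|unit_interval. C y) \<and>
      (1 - \<delta>)^3 * (\<tau> + 3 * X + R) + 3 * (1 - \<delta>)^2 * \<delta> * (column_form g C + q) = \<tau> \<and>
      (1 - \<delta>)^2 * (graphon_entropy g + \<alpha> * a + \<beta> * X - K * \<delta>^2)
        + 2 * (1 - \<delta>) * \<delta> * (LINT y|unit_interval. H (C y)) \<le> graphon_entropy g"
      unfolding s_def by blast
  qed
  then show ?thesis unfolding worth_eq_column_form .
qed

end

section \<open>Changes on null sets and the worth of columns\<close>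

text \<open>Passing from iterated to product null sets requires a measurable exceptional set, which
  measurability of both kernels provides.\<close>

lemma AE_unit_squareI:
  assumes "bounded_kernel f" "bounded_kernel h" "AE x in unit_interval. AE y in unit_interval. f x y = h x y"
  shows "AE (x, y) in unit_interval \<Otimes>\<^sub>M unit_interval. f x y = h x y"
proof -
  note [measurable] = bounded_kernel_measurable[OF assms(1)] bounded_kernel_measurable[OF assms(2)]
  have "AE p in unit_interval \<Otimes>\<^sub>M unit_interval. f (fst p) (snd p) = h (fst p) (snd p)"
    by (rule UU.AE_pair_measure) (use assms(3) in auto)
  then show ?thesis by (simp add: case_prod_unfold)
qed

lemma AE_unit_squareD:
  assumes "AE (x, y) in unit_interval \<Otimes>\<^sub>M unit_interval. P x y"
  shows "AE x in unit_interval. AE y in unit_interval. P x y"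
  using UU.AE_pair[OF assms] by simp

lemma AE_codegree_cong:
  assumes g: "graphon g" and h: "graphon h"
    and eq: "AE (x, y) in unit_interval \<Otimes>\<^sub>M unit_interval. g x y = h x y"
  shows "AE (x, y) in unit_interval \<Otimes>\<^sub>M unit_interval. codegree g x y = codegree h x y"
proof (rule AE_unit_squareI)
  \<comment> \<open>A point is good if its whole column agrees almost everywhere. Codegrees then
    agree at every pair of good points.\<close>
  define good where "good = (\<lambda>x. x \<in> {0..1} \<and> (AE y in unit_interval. g x y = h x y))"
  have ae: "AE x in unit_interval. good x"
    using AE_unit_squareD[OF eq] AE_space by eventually_elim (simp add: good_def space_unit_interval)
  have "codegree g x y = codegree h x y" if "good x" "good y" for x y
    unfolding codegree_def
  proof (rule integral_cong_AE)
    have xy: "x \<in> {0..1}" "y \<in> {0..1}" using that by (simp_all add: good_def)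
    show "(\<lambda>z. g x z * g y z) \<in> borel_measurable unit_interval" "(\<lambda>z. h x z * h y z) \<in> borel_measurable unit_interval"
      by (intro borel_measurable_times bounded_function_measurable bounded_function_column
          graphon_bounded_kernel g h xy)+
    have "AE z in unit_interval. g x z = h x z" "AE z in unit_interval. g y z = h y z"
      using that by (simp_all add: good_def)
    then show "AE z in unit_interval. g x z * g y z = h x z * h y z"
      by eventually_elim simp
  qed
  then show "AE x in unit_interval. AE y in unit_interval. codegree g x y = codegree h x y"
    using ae by (smt (verit, best) eventually_mono)
qed (use assms bounded_kernel_codegree in auto)

lemma graphon_AE_cong:
  assumes g: "graphon g" and h: "graphon h"
    and eq: "AE (x, y) in unit_interval \<Otimes>\<^sub>M unit_interval. g x y = h x y"
  shows edge_density_AE_cong: "edge_density g = edge_density h"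
    and graphon_entropy_AE_cong: "graphon_entropy g = graphon_entropy h"
    and triangle_density_AE_cong: "triangle_density g = triangle_density h"
proof -
  note b = graphon_bounded_kernel[OF g] graphon_bounded_kernel[OF h]
  show "edge_density g = edge_density h"
    unfolding edge_density_def by (rule dint_cong_AE[OF b eq])
  show "graphon_entropy g = graphon_entropy h"
    unfolding graphon_entropy_def
    by (rule dint_cong_AE[OF bounded_kernel_H[OF g] bounded_kernel_H[OF h]])
       (use eq in eventually_elim, auto)
  show "triangle_density g = triangle_density h"
    unfolding triangle_density_eq_trilin trilin_codegree[OF g] trilin_codegree[OF h]
    by (rule dint_cong_AE[OF bounded_kernel_mult[OF b(1) bounded_kernel_codegree[OF g]]
          bounded_kernel_mult[OF b(2) bounded_kernel_codegree[OF h]]])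
       (use eq AE_codegree_cong[OF assms] in eventually_elim, auto)
qed

lemma worth_kernel_AE_cong:
  assumes g: "graphon g" and h: "graphon h"
    and eq: "AE (x, y) in unit_interval \<Otimes>\<^sub>M unit_interval. g x y = h x y"
    and C: "unit_function C"
  shows "worth g \<alpha> \<beta> C = worth h \<alpha> \<beta> C"
proof -
  have "column_form g C = column_form h C"
    unfolding column_form_def
  proof (rule dint_cong_AE)
    show "bounded_kernel (\<lambda>y z. C y * C z * g y z)" "bounded_kernel (\<lambda>y z. C y * C z * h y z)"
      by (intro bounded_kernel_mult bounded_kernel_fst bounded_kernel_snd
          unit_function_bounded_function graphon_bounded_kernel g h C)+
    show "AE (y, z) in unit_interval \<Otimes>\<^sub>M unit_interval. C y * C z * g y z = C y * C z * h y z"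
      using eq by eventually_elim auto
  qed
  then show ?thesis by (simp add: worth_eq_column_form)
qed

lemma worth_column_AE_cong:
  assumes g: "graphon g" and C: "unit_function C" and D: "unit_function D"
    and eq: "AE y in unit_interval. C y = D y"
  shows "worth g \<alpha> \<beta> C = worth g \<alpha> \<beta> D"
proof -
  note bC = unit_function_bounded_function[OF C] and bD = unit_function_bounded_function[OF D]
  have 1: "(LINT y|unit_interval. H (C y)) = (LINT y|unit_interval. H (D y))"
    by (rule integral_cong_AE) (use eq bounded_function_H[OF C] bounded_function_H[OF D] in
        \<open>auto simp: bounded_function_def elim!: eventually_mono\<close>)
  have 2: "(LINT y|unit_interval. C y) = (LINT y|unit_interval. D y)"
    by (rule integral_cong_AE) (use eq bC bD in \<open>auto simp: bounded_function_def\<close>)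
  have "column_form g C = column_form g D"
    unfolding column_form_def
  proof (rule dint_cong_AE)
    show b: "bounded_kernel (\<lambda>y z. C y * C z * g y z)" "bounded_kernel (\<lambda>y z. D y * D z * g y z)"
      by (intro bounded_kernel_mult bounded_kernel_fst bounded_kernel_snd bC bD graphon_bounded_kernel g)+
    have "AE y in unit_interval. AE z in unit_interval. C y * C z * g y z = D y * D z * g y z"
      using eq by eventually_elim (use eq in \<open>auto elim!: eventually_mono\<close>)
    then show "AE (y, z) in unit_interval \<Otimes>\<^sub>M unit_interval. C y * C z * g y z = D y * D z * g y z"
      by (rule AE_unit_squareI[OF b])
  qed
  then show ?thesis using 1 2 by (simp add: worth_eq_column_form)
qed

lemma unit_function_column:
  assumes "graphon g" "x \<in> {0..1}" shows "unit_function (g x)"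
  using bounded_function_measurable[OF bounded_function_column[OF graphon_bounded_kernel[OF assms(1)] assms(2)]]
    graphon_mem[OF assms] by (auto simp: unit_function_def)

text \<open>For the column at x the quadratic part of the worth is the density of triangles through
  x. Averaging over x therefore gives the full triangle density, and likewise the full entropy and
  edge density.\<close>

lemma integral_worth_columns:
  assumes g: "graphon g"
  shows "bounded_function (\<lambda>x. worth g \<alpha> \<beta> (g x))"
    and "(LINT x|unit_interval. worth g \<alpha> \<beta> (g x)) =
      2 * graphon_entropy g - 2 * \<alpha> * edge_density g - \<beta> * triangle_density g"
proof -
  note bg = graphon_bounded_kernel[OF g]
  define T where "T = (\<lambda>x. LINT y|unit_interval. LINT z|unit_interval. g x y * g y z * g z x)"
  define A where "A = (\<lambda>x. 2 * (LINT y|unit_interval. H (g x y)))"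
  define B where "B = (\<lambda>x. (- 2 * \<alpha>) * (LINT y|unit_interval. g x y))"
  define D where "D = (\<lambda>x. (- \<beta>) * T x)"
  have eq: "worth g \<alpha> \<beta> (g x) = A x + (B x + D x)" if x: "x \<in> {0..1}" for x
  proof -
    have "column_form g (g x) = T x"
      unfolding column_form_def T_def
      by (rule dint_cong) (simp add: graphon_sym[OF g _ x])
    then show ?thesis by (simp add: worth_eq_column_form A_def B_def D_def)
  qed
  have "bounded_kernel (\<lambda>x y. LINT z|unit_interval. g x y * g y z * g z x)"
    using bounded_kernel_mult[OF bg bounded_kernel_compose[OF bg bg]] by (simp add: mult.assoc)
  then have bT: "bounded_function T"
    unfolding T_def by (rule bounded_function_integral)
  have b: "bounded_function A" "bounded_function B" "bounded_function D"
    unfolding A_def B_def D_def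
    by (intro bounded_function_cmult bounded_function_integral bounded_kernel_H g bg bT)+
  have bBD: "bounded_function (\<lambda>x. B x + D x)" by (intro bounded_function_add b)
  show "bounded_function (\<lambda>x. worth g \<alpha> \<beta> (g x))"
    using bounded_function_add[OF b(1) bBD] bounded_function_cong[OF eq] by simp
  have "(LINT x|unit_interval. worth g \<alpha> \<beta> (g x)) = (LINT x|unit_interval. A x + (B x + D x))"
    by (rule integral_unit_interval_cong) (rule eq)
  also have "\<dots> = (LINT x|unit_interval. A x) + ((LINT x|unit_interval. B x) + (LINT x|unit_interval. D x))"
    using b bBD by simp
  also have "\<dots> = 2 * graphon_entropy g - 2 * \<alpha> * edge_density g - \<beta> * triangle_density g"
    by (simp add: A_def B_def D_def T_def graphon_entropy_def edge_density_def triangle_density_def)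
  finally show "(LINT x|unit_interval. worth g \<alpha> \<beta> (g x)) =
      2 * graphon_entropy g - 2 * \<alpha> * edge_density g - \<beta> * triangle_density g" .
qed

text \<open>Solving the multiplier equation for \<open>g\<close> produces a version \<open>h\<close>
  of \<open>g\<close> with values uniformly inside (0, 1). The bound holds for \<open>h\<close> by
  \<open>worth_le\<close>, and both of its sides depend only on the kernel up to null sets.\<close>

lemma maximizer_worth_le:
  assumes max: "entropy_maximizer g" and ns: "nonsingular g" and lm: "lagrange_multipliers g \<alpha> \<beta>"
    and C: "unit_function C"
  shows "worth g \<alpha> \<beta> C \<le> 2 * graphon_entropy g - 2 * \<alpha> * edge_density g - \<beta> * triangle_density g"
proof -
  let ?P = "unit_interval \<Otimes>\<^sub>M unit_interval"
  have g: "graphon g" using max by (simp add: entropy_maximizer_def)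
  note [measurable] = bounded_kernel_measurable[OF bounded_kernel_codegree[OF g]]
  \<comment> \<open>The inverse of H' is the logistic function v \<mapsto> 1 / (1 + exp v).\<close>
  define h where "h = (\<lambda>x y. 1 / (1 + exp (\<alpha> + \<beta> * codegree g x y)))"
  \<comment> \<open>Codegrees lie in [0, 1], so \<open>M\<close> bounds \<alpha> + \<beta> G in
    absolute value.\<close>
  define M where "M = \<bar>\<alpha>\<bar> + \<bar>\<beta>\<bar>"
  define \<eta> where "\<eta> = 1 / (1 + exp M)"
  have h_mem: "h x y \<in> {\<eta>..1-\<eta>}" if "x \<in> {0..1}" "y \<in> {0..1}" for x y
  proof -
    have "\<bar>\<beta>\<bar> * \<bar>codegree g x y\<bar> \<le> \<bar>\<beta>\<bar> * 1"
      using codegree_mem[OF g that] by (intro mult_left_mono) auto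
    then have v: "\<bar>\<alpha> + \<beta> * codegree g x y\<bar> \<le> M"
      using abs_triangle_ineq[of \<alpha> "\<beta> * codegree g x y"] by (simp add: M_def abs_mult)
    have "1 + exp M \<noteq> 0" using exp_gt_zero[of M] by linarith
    then have "1 - \<eta> = 1 / (1 + exp (- M))"
      by (simp add: \<eta>_def exp_minus divide_simps)
    moreover have "\<eta> \<le> h x y" "h x y \<le> 1 / (1 + exp (- M))"
      unfolding \<eta>_def h_def using v by (auto intro!: divide_left_mono mult_pos_pos add_pos_pos)
    ultimately show ?thesis by simp
  qed
  have eta: "0 < \<eta>" unfolding \<eta>_def by (intro divide_pos_pos add_pos_pos) auto
  have h: "graphon h"
    unfolding graphon_def
  proof (intro conjI ballI)
    show "(\<lambda>(x, y). h x y) \<in> borel_measurable ?P" unfolding h_def by measurable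
    fix x y :: real assume xy: "x \<in> {0..1}" "y \<in> {0..1}"
    show "h x y \<in> {0..1}" using h_mem[OF xy] eta by auto
    show "h x y = h y x" by (simp add: h_def codegree_def mult.commute)
  qed
  have gh: "AE (x, y) in ?P. g x y = h x y"
    using lm[unfolded lagrange_multipliers_def] AE_space
  proof eventually_elim
    case (elim p)
    obtain x y where p: "p = (x, y)" by force
    have xy: "x \<in> {0..1}" "y \<in> {0..1}"
      using elim(2) by (auto simp: p space_pair_measure space_unit_interval)
    \<comment> \<open>Differentiability of \<open>H\<close> at \<open>g x y\<close> within [0, 1]
      excludes the end points, where the slope is infinite.\<close>
    have "0 < g x y" "g x y < 1" "\<alpha> + \<beta> * codegree g x y = ln ((1 - g x y) / g x y)"
      using elim(1) H_has_real_derivative_iff[OF graphon_mem[OF g xy]] by (auto simp: p)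
    then show ?case by (simp add: p h_def field_simps)
  qed
  note cg = AE_codegree_cong[OF g h gh] and cong = graphon_AE_cong[OF g h gh]
  interpret interior_maximizer h \<alpha> \<beta> \<eta>
  proof
    show "entropy_maximizer h" using max h cong by (simp add: entropy_maximizer_def)
    show "0 < \<eta>" by (rule eta)
    show "h x y \<in> {\<eta>..1-\<eta>}" if "x \<in> {0..1}" "y \<in> {0..1}" for x y using h_mem that .
    show "AE (x, y) in ?P. ln ((1 - h x y) / h x y) = \<alpha> + \<beta> * codegree h x y"
      using cg
    proof eventually_elim
      case (elim p)
      obtain x y where p: "p = (x, y)" by force
      let ?v = "\<alpha> + \<beta> * codegree g x y"
      have "1 + exp ?v \<noteq> 0" using exp_gt_zero[of ?v] by linarith
      then have "(1 - h x y) / h x y = exp ?v" unfolding h_def by (simp add: field_simps)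
      then show ?case using elim by (simp add: p)
    qed
    show "\<not> (\<exists>c. AE (x, y) in ?P. codegree h x y = c)"
    proof
      assume "\<exists>c. AE (x, y) in ?P. codegree h x y = c"
      then obtain c where "AE (x, y) in ?P. codegree h x y = c" by blast
      then have "AE (x, y) in ?P. 0 < g x y \<and> g x y < 1 \<longrightarrow> codegree g x y = c"
        using cg by eventually_elim auto
      then show False using ns unfolding nonsingular_def by blast
    qed
  qed
  show ?thesis
    using worth_le[OF C] worth_kernel_AE_cong[OF g h gh C] cong by simp
qed

theorem theorem11:
  fixes g :: "real \<Rightarrow> real \<Rightarrow> real" and \<alpha> \<beta> :: real
  assumes "entropy_maximizer g"
    and "nonsingular g"
    and "lagrange_multipliers g \<alpha> \<beta>"
  shows "\<exists>g'. graphon g' \<and>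
           (AE (x, y) in unit_interval \<Otimes>\<^sub>M unit_interval. g' x y = g x y) \<and>
           (\<forall>x\<in>{0..1}. worth_maximizer g \<alpha> \<beta> (g' x)) \<and>
           (\<forall>x\<in>{0..1}. \<forall>x'\<in>{0..1}. worth g \<alpha> \<beta> (g' x) = worth g \<alpha> \<beta> (g' x'))"
proof -
  have g: "graphon g" using assms(1) by (simp add: entropy_maximizer_def)
  note [measurable] = bounded_kernel_measurable[OF graphon_bounded_kernel[OF g]]
  define W where "W = 2 * graphon_entropy g - 2 * \<alpha> * edge_density g - \<beta> * triangle_density g"
  define w where "w = (\<lambda>x. worth g \<alpha> \<beta> (g x))"
  have W: "worth g \<alpha> \<beta> C \<le> W" if "unit_function C" for C
    unfolding W_def by (rule maximizer_worth_le[OF assms that])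
  have bw: "bounded_function w" and iw: "(LINT x|unit_interval. w x) = W"
    unfolding w_def W_def by (rule integral_worth_columns[OF g])+
  note [measurable] = bounded_function_measurable[OF bw]
  have bd: "bounded_function (\<lambda>x. W + (- 1) * w x)"
    by (intro bounded_function_add bounded_function_cmult bw bounded_function_const)
  \<comment> \<open>\<open>W\<close> is both an upper bound and the mean of \<open>w\<close>, so the
    nonnegative function \<open>W - w\<close> has integral 0 and vanishes almost everywhere.\<close>
  have "(LINT x|unit_interval. W + (- 1) * w x) = 0"
    using bw iw measure_unit_interval by simp
  then have "AE x in unit_interval. W + (- 1) * w x = 0"
    using W unit_function_column[OF g]
    by (subst (asm) integral_nonneg_eq_0_iff_AE[OF integrable_bounded_function[OF bd]])
       (auto simp: w_def space_unit_interval intro!: AE_I2)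
  then have ae: "AE x in unit_interval. w x = W" by eventually_elim simp
  have "ae_filter unit_interval \<noteq> bot"
    by (simp add: ae_filter_eq_bot_iff emeasure_restrict_space space_restrict_space)
  then obtain x0 where x0: "x0 \<in> {0..1}" "w x0 = W"
    using eventually_happens'[OF _ eventually_conj[OF ae AE_space]] by (auto simp: space_unit_interval)
  \<comment> \<open>Points with a bad column are redirected to the good point \<open>x0\<close>.
    Applying \<open>r\<close> in both variables keeps the graphon symmetric.\<close>
  define r where "r = (\<lambda>x. if w x = W then x else x0)"
  have r_mem: "r x \<in> {0..1}" "w (r x) = W" if "x \<in> {0..1}" for x
    using that x0 by (auto simp: r_def)
  have r_ae: "AE x in unit_interval. r x = x" using ae by eventually_elim (simp add: r_def)
  have [measurable]: "(\<lambda>x. x) \<in> borel_measurable unit_interval"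
    by (rule measurable_restrict_space1) simp
  have [measurable]: "r \<in> measurable unit_interval unit_interval"
    unfolding measurable_restrict_space2_iff using r_mem
    by (auto simp: space_unit_interval r_def)
  define g' where "g' = (\<lambda>x y. g (r x) (r y))"
  have g': "graphon g'"
    unfolding graphon_def
  proof (intro conjI ballI)
    show "(\<lambda>(x, y). g' x y) \<in> borel_measurable (unit_interval \<Otimes>\<^sub>M unit_interval)"
      unfolding g'_def by measurable
    fix x y :: real assume "x \<in> {0..1}" "y \<in> {0..1}"
    then show "g' x y \<in> {0..1}" "g' x y = g' y x"
      unfolding g'_def using graphon_mem[OF g] graphon_sym[OF g] r_mem by blast+
  qed
  have worth: "worth g \<alpha> \<beta> (g' x) = W" if x: "x \<in> {0..1}" for x
  proof -
    \<comment> \<open>The columns \<open>g' x\<close> and \<open>g (r x)\<close> differ only where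
      \<open>r\<close> moves y, a null set, while the kernel inside the worth remains
      \<open>g\<close>.\<close>
    have "worth g \<alpha> \<beta> (g' x) = worth g \<alpha> \<beta> (g (r x))"
      using r_ae by (intro worth_column_AE_cong unit_function_column g g' x r_mem)
        (auto simp: g'_def elim!: eventually_mono)
    then show ?thesis using r_mem[OF x] by (simp add: w_def)
  qed
  have "AE x in unit_interval. AE y in unit_interval. g' x y = g x y"
    using r_ae by eventually_elim (use r_ae in \<open>auto simp: g'_def elim!: eventually_mono\<close>)
  then have "AE (x, y) in unit_interval \<Otimes>\<^sub>M unit_interval. g' x y = g x y"
    by (rule AE_unit_squareI[OF graphon_bounded_kernel[OF g'] graphon_bounded_kernel[OF g]])
  moreover have "worth_maximizer g \<alpha> \<beta> (g' x)" if "x \<in> {0..1}" for x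
    unfolding worth_maximizer_def using unit_function_column[OF g' that] worth[OF that] W by simp
  ultimately show ?thesis using g' worth by (intro exI[of _ g']) auto
qed

end
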